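(* Let $\alpha>0$ be a constant, let $n$ be even, $m=n^{\alpha}$, and let $\omega=\omega(n)$ be a real-valued function of $n$. Let $$ p_1=p_1(n)= \begin{cases} \dfrac{\ln n+\omega}{m}, & \text{for } \alpha\le 1;\\[2mm] \sqrt{\dfrac{\ln n+\omega}{nm}}, & \text{for } \alpha>1, \end{cases} $$ where $\omega$ is such that $p_1$ is well defined and lies in $[0,1]$. Then, as $n\to\infty$ (through even integers): (i) if $\omega\to-\infty$, then with probability tending to $1$ the random intersection graph $\mathcal{G}(n,m,p_1)$ does not contain a perfect matching; (ii) if $\omega\to\infty$, then with probability tending to $1$ the random intersection graph $\mathcal{G}(n,m,p_1)$ contains a perfect matching.
   Context: The random intersection graph $\mathcal{G}(n,m,p)$ is defined as follows. Let $\mathcal{V}$ be a set of $n$ vertices and $\mathcal{W}$ an auxiliary set of $m$ features. Each vertex $v\in\mathcal{V}$ is assigned a random subset $W_v\subseteq\mathcal{W}$, where each feature $w\in\mathcal{W}$ belongs to $W_v$ with probability $p$, independently over all pairs $(v,w)$. Two distinct vertices $v_1,v_2$ are adjacent if and only if $W_{v_1}\cap W_{v_2}\neq\emptyset$. All limits are taken as $n\to\infty$. *)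

theory Defs
  imports "HOL-Probability.Probability"
begin

text \<open>
  A simple graph is a pair of its vertex set and its set of edges, each edge being a
  two-element set of vertices.
\<close>

type_synonym 'a graph = "'a set \<times> 'a set set"

definition is_matching :: "'a graph \<Rightarrow> 'a set set \<Rightarrow> bool" where
  "is_matching G M \<longleftrightarrow> M \<subseteq> snd G \<and> pairwise disjnt M"

definition has_perfect_matching :: "'a graph \<Rightarrow> bool" where
  "has_perfect_matching G \<longleftrightarrow> (\<exists>M. is_matching G M \<and> \<Union>M = fst G)"

definition intersection_graph :: "'v set \<Rightarrow> ('v \<Rightarrow> 'w set) \<Rightarrow> 'v graph" where
  "intersection_graph V W =
     (V, {{u, v} | u v. u \<in> V \<and> v \<in> V \<and> u \<noteq> v \<and> W u \<inter> W v \<noteq> {}})"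

text \<open>
  The vertices are \<open>{..<n}\<close> and the features are \<open>{..<m}\<close>. The random function \<open>B\<close> holds
  one independent Bernoulli variable for each pair; \<open>B (v, w)\<close> says that vertex \<open>v\<close> has
  feature \<open>w\<close>.
\<close>

definition random_intersection_graph :: "nat \<Rightarrow> nat \<Rightarrow> real \<Rightarrow> nat graph pmf" where
  "random_intersection_graph n m p =
     map_pmf (\<lambda>B. intersection_graph {..<n} (\<lambda>v. {w \<in> {..<m}. B (v, w)}))
       (Pi_pmf ({..<n} \<times> {..<m}) False (\<lambda>_. bernoulli_pmf p))"

text \<open>
  The argument \<open>x\<close> is the value of \<open>\<omega>\<close> at \<open>n\<close>. In the second case \<^term>\<open>sqrt\<close> is
  total and negative on negative reals, so for \<open>n, m > 0\<close> the condition
  \<open>0 \<le> matching_prob \<alpha> n m x\<close> says precisely that the radicand is nonnegative.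
\<close>

definition matching_prob :: "real \<Rightarrow> nat \<Rightarrow> nat \<Rightarrow> real \<Rightarrow> real" where
  "matching_prob \<alpha> n m x =
     (if \<alpha> \<le> 1 then (ln (real n) + x) / real m
      else sqrt ((ln (real n) + x) / (real n * real m)))"

definition even_sequentially :: "nat filter" where
  "even_sequentially = inf sequentially (principal {n. even n})"

end

theory Submission
  imports Defs "HOL-Real_Asymp.Real_Asymp"
begin

text \<open>
  Put \<open>\<theta> = (ln n + \<omega>) / m\<close>; then \<open>p = \<theta>\<close> for \<open>\<alpha> \<le> 1\<close> and \<open>n p\<^sup>2 = \<theta>\<close> for \<open>\<alpha> > 1\<close>, and in both
  cases a vertex is isolated with probability at least about \<open>(1 - \<theta>)^m\<close>. If \<open>\<omega> \<longrightarrow> -\<infinity>\<close>, the second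
  moment method yields an isolated vertex.

  If \<open>\<omega> \<longrightarrow> \<infinity>\<close>, the graph contains the union of two independent random intersection graphs, the
  first of which still lies above the threshold. With high probability the first one is an
  expander: every set \<open>S\<close> of at most \<open>n / 16\<close> vertices has at least \<open>card S\<close> neighbours. This is a
  union bound over minimal counterexamples \<open>S\<close> together with \<open>U = S \<union> N(S)\<close>: no feature joins \<open>S\<close> to
  the complement of \<open>U\<close>, and the features touching \<open>S\<close> connect \<open>U\<close>. In an expander without a perfect
  matching, alternating paths produce quadratically many pairs of vertices whose joining enlarges
  a maximum matching, so each feature of the second graph has a good chance to enlarge it. For
  \<open>\<alpha> \<le> 1\<close> the first graph already leaves at most \<open>m\<close> vertices unmatched and the second graph splits
  off a part of \<open>p\<close>; for \<open>\<alpha> > 1\<close> it splits off a part of the features.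
\<close>

section \<open>Maximum matchings and expansion\<close>

text \<open>Choosing \<open>U\<close> with u elements costs about n^u, while closedness of
  \<open>U\<close> around \<open>S\<close> only gives about n^(-s) with s barely above u/2.
  Connectivity of \<open>U\<close> has to pay the missing power, which is why minimal
  counterexamples are taken. Each sprinkled feature is credited with one new pair only, and this
  dictates how the randomness is split when \<omega> grows slowly. For \<alpha> \<le> 1 setting
  aside features would leave a small fraction of the m features against a deficiency that may be of
  order m; thinning \<open>p\<close> keeps all m trials, each successful with high probability
  because n times the spare probability is at least of order \<omega>. For \<alpha> > 1 thinning
  \<open>p\<close> would produce only about n \<omega>^2 / ln n pairs in the second round, possibly
  o(n); setting aside a fraction of order \<omega> / ln n of the features at full \<open>p\<close>
  produces about n \<omega> pairs, enough against a deficiency of up to n.\<close>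

definition joined :: "'a set set \<Rightarrow> 'a \<Rightarrow> 'a \<Rightarrow> bool" where
  "joined F u v \<longleftrightarrow> u \<noteq> v \<and> (\<exists>X\<in>F. u \<in> X \<and> v \<in> X)"

text \<open>A matching encoded as an involution whose fixed points are the uncovered vertices;
  switching along an alternating path becomes a function update.\<close>

definition pairing :: "'a set \<Rightarrow> 'a set set \<Rightarrow> ('a \<Rightarrow> 'a) \<Rightarrow> bool" where
  "pairing V F f \<longleftrightarrow>
     (\<forall>x\<in>V. f x \<in> V \<and> f (f x) = x \<and> (f x \<noteq> x \<longrightarrow> joined F x (f x)))"

definition unpaired :: "'a set \<Rightarrow> ('a \<Rightarrow> 'a) \<Rightarrow> 'a set" where
  "unpaired V f = {x \<in> V. f x = x}"

definition deficiency :: "'a set \<Rightarrow> 'a set set \<Rightarrow> nat" where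
  "deficiency V F = (LEAST d. \<exists>f. pairing V F f \<and> card (unpaired V f) = d)"

definition nbhd :: "'a set \<Rightarrow> 'a set set \<Rightarrow> 'a set \<Rightarrow> 'a set" where
  "nbhd V F S = {x \<in> V - S. \<exists>a\<in>S. joined F a x}"

text \<open>The factor 16 puts the closed neighbourhood of a smallest violating set below n / 8, so
  that the moment estimates can add several quantities of that size and stay well below n.\<close>

definition expander :: "'a set \<Rightarrow> 'a set set \<Rightarrow> bool" where
  "expander V F \<longleftrightarrow>
     (\<forall>S\<subseteq>V. S \<noteq> {} \<longrightarrow> 16 * card S \<le> card V \<longrightarrow> card S \<le> card (nbhd V F S))"

lemma joined_sym: "joined F u v \<Longrightarrow> joined F v u"
  by (auto simp: joined_def)

lemma joined_mono: "F \<subseteq> F' \<Longrightarrow> joined F u v \<Longrightarrow> joined F' u v"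
  by (auto simp: joined_def)

lemma pairing_mono: "F \<subseteq> F' \<Longrightarrow> pairing V F f \<Longrightarrow> pairing V F' f"
  by (auto simp: pairing_def intro: joined_mono)

lemma pairing_id: "pairing V F (\<lambda>x. x)"
  by (auto simp: pairing_def)

lemma deficiency_attained: "\<exists>f. pairing V F f \<and> card (unpaired V f) = deficiency V F"
  unfolding deficiency_def by (rule LeastI_ex) (use pairing_id in blast)

lemma deficiency_le: "pairing V F f \<Longrightarrow> deficiency V F \<le> card (unpaired V f)"
  unfolding deficiency_def by (rule Least_le) blast

text \<open>Stated for \<open>joined\<close> instead of inclusion of families because merging two
  rounds replaces members \<open>X\<close> and \<open>Y\<close> by \<open>X \<union> Y\<close>: the
  families are not nested, but all joined pairs survive.\<close>

lemma deficiency_antimono_joined: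
  assumes "\<And>u v. joined F u v \<Longrightarrow> joined F' u v"
  shows "deficiency V F' \<le> deficiency V F"
proof -
  obtain f where f: "pairing V F f" "card (unpaired V f) = deficiency V F"
    using deficiency_attained by metis
  then have "pairing V F' f" using assms unfolding pairing_def by blast
  from deficiency_le[OF this] show ?thesis using f(2) by simp
qed

lemma deficiency_antimono: "F \<subseteq> F' \<Longrightarrow> deficiency V F' \<le> deficiency V F"
  by (rule deficiency_antimono_joined) (rule joined_mono)

lemma deficiency_le_card: "finite V \<Longrightarrow> deficiency V F \<le> card V"
  using deficiency_le[OF pairing_id, of V F] by (auto simp: unpaired_def)

lemma expander_mono:
  assumes "finite V" "F \<subseteq> F'" "expander V F"
  shows "expander V F'"
proof -
  have "card (nbhd V F S) \<le> card (nbhd V F' S)" for S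
    by (intro card_mono) (use assms in \<open>auto simp: nbhd_def intro: joined_mono\<close>)
  then show ?thesis
    using assms(3) unfolding expander_def by (meson order_trans)
qed

text \<open>The 2-cycles \<open>{x, f x}\<close> partition the paired vertices.\<close>

lemma even_card_paired:
  assumes "finite V" "pairing V F f"
  shows "even (card (V - unpaired V f))"
proof -
  let ?C = "(\<lambda>x. {x, f x}) ` (V - unpaired V f)"
  have f: "f x \<in> V" "f (f x) = x" if "x \<in> V" for x
    using assms(2) that by (auto simp: pairing_def)
  have U: "\<Union>?C = V - unpaired V f"
    using f by (fastforce simp: unpaired_def)
  have "2 dvd card (\<Union>?C)"
  proof (rule dvd_partition)
    show "\<forall>c1\<in>?C. \<forall>c2\<in>?C. c1 \<noteq> c2 \<longrightarrow> c1 \<inter> c2 = {}"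
      using f by (auto simp: unpaired_def) metis+
  qed (use assms U in \<open>auto simp: unpaired_def card_insert_if\<close>)
  then show ?thesis using U by simp
qed

text \<open>Parity turns a positive deficiency into two distinct unpaired vertices, the starting
  point of \<open>boosters\<close>.\<close>

lemma even_card_unpaired:
  assumes "finite V" "even (card V)" "pairing V F f"
  shows "even (card (unpaired V f))"
proof -
  have "unpaired V f \<subseteq> V" by (auto simp: unpaired_def)
  then have "card V = card (V - unpaired V f) + card (unpaired V f)"
    by (metis assms(1) card_Diff_subset card_mono finite_subset le_add_diff_inverse2)
  then show ?thesis using even_card_paired[OF assms(1,3)] assms(2) by auto
qed

text \<open>The only improvement step needed: alternating paths are already absorbed into
  \<open>g\<close>, so augmenting means pairing two of its fixed points with each other.\<close>

lemma pairing_augment: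
  assumes "finite V" "pairing V F g" "a \<in> unpaired V g" "x \<in> unpaired V g" "joined F a x"
  shows "deficiency V F + 2 \<le> card (unpaired V g)"
proof -
  let ?g = "g(x := a, a := x)"
  have ax: "a \<noteq> x" using assms(5) by (auto simp: joined_def)
  have av: "a \<in> V" "x \<in> V" "g a = a" "g x = x" using assms by (auto simp: unpaired_def)
  have P: "pairing V F ?g"
    unfolding pairing_def
  proof (intro ballI conjI impI)
    fix y assume y: "y \<in> V"
    have gy: "g y \<in> V" "g (g y) = y" "g y \<noteq> y \<longrightarrow> joined F y (g y)"
      using assms(2) y by (auto simp: pairing_def)
    show "?g y \<in> V" using gy av by auto
    show "?g (?g y) = y" using gy av ax by (auto simp: fun_upd_def)
    show "joined F y (?g y)" if "?g y \<noteq> y" using that gy joined_sym[OF assms(5)] assms(5) by (auto split: if_splits)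
  qed
  have "unpaired V ?g = unpaired V g - {a, x}" using av ax by (auto simp: unpaired_def)
  moreover have "card (unpaired V g - {a, x}) = card (unpaired V g) - 2"
    using assms(1,3,4) ax by (subst card_Diff_subset) (auto simp: unpaired_def)
  moreover have "2 \<le> card (unpaired V g)"
    using card_mono[of "unpaired V g" "{a, x}"] assms(1,3,4) ax by (auto simp: unpaired_def)
  ultimately show ?thesis using deficiency_le[OF P] by simp
qed

text \<open>States of an alternating search from \<open>u\<close>: the pairing \<open>g\<close> arises from \<open>f\<close> by switching along
  an alternating path from \<open>u\<close> to \<open>a\<close>.\<close>

inductive alternating :: "'a set \<Rightarrow> 'a set set \<Rightarrow> ('a \<Rightarrow> 'a) \<Rightarrow> 'a \<Rightarrow> ('a \<Rightarrow> 'a) \<Rightarrow> 'a \<Rightarrow> bool"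
  for V F f u where
  start: "alternating V F f u f u"
| step: "alternating V F f u g a \<Longrightarrow> joined F a x \<Longrightarrow> x \<in> V \<Longrightarrow> g x \<noteq> x \<Longrightarrow>
    alternating V F f u (g(x := a, a := x, g x := g x)) (g x)"

text \<open>A step pairs \<open>x\<close> with the free endpoint \<open>a\<close> and frees the old
  mate of \<open>x\<close>, so the unpaired set only trades \<open>u\<close> for the current
  endpoint. That the endpoint is not another vertex left unpaired by \<open>f\<close> keeps the
  number of unpaired vertices constant.\<close>

lemma alternating_invariant:
  assumes "pairing V F f" "u \<in> unpaired V f" "alternating V F f u g a"
  shows "pairing V F g \<and> a \<in> V \<and> a \<notin> unpaired V f - {u} \<and>
    unpaired V g = insert a (unpaired V f - {u})"
  using assms(3)
proof induction
  case start
  then show ?case using assms by (auto simp: unpaired_def)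
next
  case (step g a x)
  define y where "y = g x"
  let ?g = "g(x := a, a := x, y := y)"
  have IH: "pairing V F g" "a \<in> V" "a \<notin> unpaired V f - {u}" 
    "unpaired V g = insert a (unpaired V f - {u})" using step.IH by auto
  have ga: "g a = a" using IH(4) by (auto simp: unpaired_def)
  have ax: "a \<noteq> x" using step by (auto simp: joined_def)
  have yx: "y \<noteq> x" using step by (auto simp: y_def)
  have yV: "y \<in> V" and gy: "g y = x" and gx: "g x = y"
    using IH(1) step by (auto simp: pairing_def y_def)
  have ya: "y \<noteq> a" using gy ga ax by auto
  have P: "pairing V F ?g"
    unfolding pairing_def
  proof (intro ballI conjI impI)
    fix t assume t: "t \<in> V"
    have gt: "g t \<in> V" "g (g t) = t" "g t \<noteq> t \<longrightarrow> joined F t (g t)"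
      using IH(1) t by (auto simp: pairing_def)
    show "?g t \<in> V" using gt IH(2) step(3) yV by auto
    show "?g (?g t) = t"
      using gt gx gy ga ax yx ya by (auto simp: fun_upd_def)
    show "joined F t (?g t)" if "?g t \<noteq> t"
      using that gt joined_sym[OF step(2)] step(2) by (auto split: if_splits)
  qed
  have U: "unpaired V ?g = insert y (unpaired V g - {a})"
    using ax yx ya yV IH(2) step(3) by (auto simp: unpaired_def gx)
  have "y \<notin> unpaired V g" using gy yx by (auto simp: unpaired_def)
  then have "y \<notin> unpaired V f - {u}" using IH by auto
  moreover have "unpaired V ?g = insert y (unpaired V f - {u})"
    using U IH(3,4) by auto
  ultimately show ?case using P yV unfolding gx by blast
qed

text \<open>A step changes the mates of the old endpoint, the new endpoint and the vertex between
  them. If \<open>x\<close> is never an endpoint, its mate can only change when \<open>x\<close> is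
  that middle vertex, and then its previous mate becomes an endpoint; at the first such change this
  mate is \<open>f x\<close>.\<close>

lemma alternating_mate:
  assumes "pairing V F f" "u \<in> unpaired V f" "alternating V F f u g a"
    and "x \<in> V" "\<And>h. \<not> alternating V F f u h x"
  shows "g x = f x \<or> (\<exists>h. alternating V F f u h (f x))"
  using assms(3)
proof induction
  case start
  then show ?case by auto
next
  case (step g a y)
  have s: "alternating V F f u (g(y := a, a := y, g y := g y)) (g y)"
    by (rule alternating.step) (use step in auto)
  have "x \<noteq> a" using step assms(5) by blast
  moreover have "x \<noteq> g y" using s assms(5) by metis
  ultimately show ?case using step.IH s by (cases "x = y") auto
qed

text \<open>A maximum matching sends the neighbours of the set \<open>A\<close> of search endpoints
  injectively into \<open>A - {u}\<close>.\<close>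

lemma exposed_pairs:
  assumes fin: "finite V" and f: "pairing V F f" "card (unpaired V f) = deficiency V F"
    and uv: "u \<in> unpaired V f" "v \<in> unpaired V f" "u \<noteq> v"
  obtains A where "A \<subseteq> V" "A \<noteq> {}" "card (nbhd V F A) < card A"
    "\<And>a. a \<in> A \<Longrightarrow> \<exists>g. pairing V F g \<and> card (unpaired V g) = deficiency V F \<and>
       a \<in> unpaired V g \<and> v \<in> unpaired V g \<and> a \<noteq> v"
proof
  let ?A = "{a. \<exists>g. alternating V F f u g a}"
  note inv = alternating_invariant[OF f(1) uv(1)]
  show AV: "?A \<subseteq> V" using inv by blast
  have uA: "u \<in> ?A" by (auto intro: alternating.start)
  then show "?A \<noteq> {}" by blast
  have finU: "finite (unpaired V f)" using fin by (auto simp: unpaired_def)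
  have card_g: "card (unpaired V g) = deficiency V F" if "alternating V F f u g a" for g a
    using inv[OF that] card_Suc_Diff1[OF finU uv(1)] finU f(2) by simp
  show "\<exists>g. pairing V F g \<and> card (unpaired V g) = deficiency V F \<and>
       a \<in> unpaired V g \<and> v \<in> unpaired V g \<and> a \<noteq> v" if "a \<in> ?A" for a
    using that inv card_g uv by blast
  have "f x \<in> ?A - {u}" if x: "x \<in> nbhd V F ?A" for x
  proof -
    from x obtain a g where ag: "alternating V F f u g a" "joined F a x" "x \<in> V"
      and nx: "\<And>h. \<not> alternating V F f u h x" by (auto simp: nbhd_def)
    have xu: "x \<noteq> u" using nx alternating.start by metis
    \<comment> \<open>An unpaired \<open>x\<close> joined to the endpoint \<open>a\<close> would
      improve the optimal pairing \<open>g\<close>; so \<open>x\<close> has a mate and the search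
      can step through it.\<close>
    have gx: "g x \<noteq> x"
    proof
      assume "g x = x"
      then have "deficiency V F + 2 \<le> card (unpaired V g)"
        using inv[OF ag(1)] ag by (intro pairing_augment[OF fin _ _ _ ag(2)]) (auto simp: unpaired_def)
      then show False using card_g[OF ag(1)] by simp
    qed
    have "g x \<in> ?A" using alternating.step[OF ag gx] by blast
    then have "f x \<in> ?A" using alternating_mate[OF f(1) uv(1) ag(1,3) nx] by auto
    moreover have "f x \<noteq> u" using f(1) ag(3) uv(1) xu by (auto simp: pairing_def unpaired_def)
    ultimately show ?thesis by blast
  qed
  then have "f ` nbhd V F ?A \<subseteq> ?A - {u}" by blast
  moreover have "inj_on f (nbhd V F ?A)"
    using f(1) by (intro inj_on_inverseI[of _ f]) (auto simp: pairing_def nbhd_def)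
  moreover have finA: "finite ?A" using AV fin finite_subset by blast
  ultimately have "card (nbhd V F ?A) \<le> card (?A - {u})"
    by (meson card_inj_on_le finite_Diff)
  also have "\<dots> < card ?A" using uA finA by (intro card_Diff1_less)
  finally show "card (nbhd V F ?A) < card ?A" .
qed

text \<open>Two-stage rotation: with \<open>v\<close> kept unpaired, the other endpoint
  \<open>u\<close> reaches every \<open>a\<close> in \<open>A\<close>; then \<open>a\<close> is kept
  and \<open>v\<close> is moved, reaching every \<open>b\<close> in \<open>B a\<close>. Each such
  pair is left unpaired by some optimal pairing. Endpoint sets have fewer neighbours than elements,
  so expansion forces them above n / 16.\<close>

lemma boosters:
  assumes fin: "finite V" and "even (card V)" and ex: "expander V F" and "deficiency V F > 0"
  obtains A B where "A \<subseteq> V" "card V < 16 * card A"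
    "\<And>a. a \<in> A \<Longrightarrow> B a \<subseteq> V \<and> card V < 16 * card (B a)"
    "\<And>a b X. a \<in> A \<Longrightarrow> b \<in> B a \<Longrightarrow> a \<in> X \<Longrightarrow> b \<in> X \<Longrightarrow>
       deficiency V (insert X F) + 2 \<le> deficiency V F"
proof -
  let ?M = "\<lambda>f a b. pairing V F f \<and> card (unpaired V f) = deficiency V F \<and>
       a \<in> unpaired V f \<and> b \<in> unpaired V f \<and> a \<noteq> b"
  have grow: "\<exists>A\<subseteq>V. card V < 16 * card A \<and> (\<forall>a\<in>A. \<exists>g. ?M g a v)" if "?M f u v" for f u v
  proof -
    have fu: "pairing V F f" "card (unpaired V f) = deficiency V F" "u \<in> unpaired V f"
      "v \<in> unpaired V f" "u \<noteq> v" using that by auto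
    obtain A where A: "A \<subseteq> V" "A \<noteq> {}" "card (nbhd V F A) < card A"
      "\<And>a. a \<in> A \<Longrightarrow> \<exists>g. ?M g a v"
      using exposed_pairs[OF fin fu] by metis
    then have "card V < 16 * card A"
      using ex unfolding expander_def by (meson linorder_not_less)
    with A show ?thesis by blast
  qed
  obtain f where f: "pairing V F f" "card (unpaired V f) = deficiency V F"
    using deficiency_attained by metis
  then have "even (card (unpaired V f))" using even_card_unpaired fin assms(2) by blast
  then have "2 \<le> card (unpaired V f)" using assms(4) f(2) by (metis dvd_imp_le)
  then obtain u v where "u \<in> unpaired V f" "v \<in> unpaired V f" "u \<noteq> v"
    by (metis card_2_iff' obtain_subset_with_card_n subsetD)
  then obtain A where A: "A \<subseteq> V" "card V < 16 * card A" "\<And>a. a \<in> A \<Longrightarrow> \<exists>g. ?M g a v"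
    using grow f by meson
  have "\<exists>B. B \<subseteq> V \<and> card V < 16 * card B \<and> (\<forall>b\<in>B. \<exists>g. ?M g b a)" if a: "a \<in> A" for a
  proof -
    obtain g where "?M g a v" using A(3)[OF a] by blast
    \<comment> \<open>The roles are exchanged: \<open>a\<close> now stays unpaired while
      \<open>v\<close> moves.\<close>
    then have "?M g v a" by auto
    from grow[OF this] show ?thesis by blast
  qed
  then obtain B where B: "\<And>a. a \<in> A \<Longrightarrow> B a \<subseteq> V \<and> card V < 16 * card (B a) \<and> (\<forall>b\<in>B a. \<exists>g. ?M g b a)"
    by metis
  show ?thesis
  proof (rule that[of A B])
    fix a b X assume ab: "a \<in> A" "b \<in> B a" "a \<in> X" "b \<in> X"
    then obtain g where g: "?M g b a" using B by blast
    then have "deficiency V (insert X F) + 2 \<le> card (unpaired V g)"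
      using ab pairing_mono[OF subset_insertI, of V F g X]
      by (intro pairing_augment[OF fin, of "insert X F" g b a]) (auto simp: joined_def)
    then show "deficiency V (insert X F) + 2 \<le> deficiency V F" using g by simp
  qed (use A(1,2) B in blast)+
qed

text \<open>The set \<open>T\<close> grows from \<open>{u}\<close>; each member of \<open>F\<close>
  that crosses its boundary already meets \<open>T\<close>, so it adds at most
  \<open>card X - 1\<close> new vertices.\<close>

lemma card_connected_le:
  fixes F :: "'a set set"
  assumes "finite U" "finite F" "u \<in> U" "\<And>X. X \<in> F \<Longrightarrow> X \<subseteq> U"
    and cut: "\<And>T. u \<in> T \<Longrightarrow> T \<subset> U \<Longrightarrow> \<exists>X\<in>F. X \<inter> T \<noteq> {} \<and> \<not> X \<subseteq> T"
  shows "card U \<le> 1 + (\<Sum>X\<in>F. card X - 1)"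
proof -
  have "\<exists>E\<subseteq>F. card U \<le> 1 + (\<Sum>X\<in>E. card X - 1)"
    if "u \<in> T" "T \<subseteq> U" "E \<subseteq> F" "\<forall>X\<in>E. X \<subseteq> T" "card T \<le> 1 + (\<Sum>X\<in>E. card X - 1)" for T E
    using that
  proof (induction "card (U - T)" arbitrary: T E rule: less_induct)
    case less
    show ?case
    proof (cases "T = U")
      case True
      then show ?thesis using less.prems(3,5) by (intro exI[of _ E]) simp
    next
      case False
      then have "T \<subset> U" using less.prems(2) by blast
      from cut[OF less.prems(1) this] obtain X where X: "X \<in> F" "X \<inter> T \<noteq> {}" "\<not> X \<subseteq> T"
        by blast
      have XU: "X \<subseteq> U" using assms X by blast
      have finX: "finite X" "finite T" "finite E"
        using finite_subset[OF XU] finite_subset[OF less.prems(2)] finite_subset[OF less.prems(3)]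
          assms(1,2) by auto
      have "X \<notin> E" using X(3) less.prems(4) by blast
      have "card (X \<inter> T) > 0" using X(2) finX by (simp add: card_gt_0_iff)
      then have "card (X - T) \<le> card X - 1" using finX by (simp add: card_Diff_subset_Int)
      moreover have "card (T \<union> X) = card T + card (X - T)"
        using finX card_Un_disjoint[of T "X - T"] by (simp add: Un_Diff_cancel)
      ultimately have c: "card (T \<union> X) \<le> 1 + (\<Sum>X\<in>insert X E. card X - 1)"
        using less.prems(5) \<open>X \<notin> E\<close> finX by simp
      have "U - (T \<union> X) \<subset> U - T" using X XU by blast
      then have "card (U - (T \<union> X)) < card (U - T)"
        using assms(1) by (intro psubset_card_mono) auto
      then show ?thesis
        by (rule less.hyps[of "T \<union> X" "insert X E"]) (use c less.prems(1-4) X XU in auto)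
    qed
  qed
  from this[of "{u}" "{}"] assms(3) obtain E where "E \<subseteq> F" "card U \<le> 1 + (\<Sum>X\<in>E. card X - 1)"
    by auto
  then show ?thesis using sum_mono2[OF assms(2), of E "\<lambda>X. card X - 1"] by simp
qed

text \<open>A non-expanding set of minimal size is connected to its neighbourhood.\<close>

lemma not_expander_witness:
  assumes fin: "finite V" "finite F" and FV: "\<And>X. X \<in> F \<Longrightarrow> X \<subseteq> V" and "\<not> expander V F"
  obtains S U where "S \<subseteq> U" "U \<subseteq> V" "S \<noteq> {}" "card U < 2 * card S" "16 * card S \<le> card V"
    "\<And>X. X \<in> F \<Longrightarrow> X \<inter> S \<noteq> {} \<Longrightarrow> X \<subseteq> U"
    "card U \<le> 1 + (\<Sum>X | X \<in> F \<and> X \<inter> S \<noteq> {}. card X - 1)"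
proof -
  let ?bad = "\<lambda>S. S \<subseteq> V \<and> S \<noteq> {} \<and> 16 * card S \<le> card V \<and> card (nbhd V F S) < card S"
  obtain S where S: "?bad S" and min: "\<And>S'. ?bad S' \<Longrightarrow> card S \<le> card S'"
    using ex_has_least_nat[of ?bad _ card] assms(4) unfolding expander_def by (metis linorder_not_less)
  define U where "U = S \<union> nbhd V F S"
  have finS: "finite S" using S fin finite_subset by blast
  have finN: "finite (nbhd V F T)" for T using fin by (auto simp: nbhd_def)
  have UV: "U \<subseteq> V" using S by (auto simp: U_def nbhd_def)
  have touch: "X \<subseteq> U" if X: "X \<in> F" "X \<inter> S \<noteq> {}" for X
  proof
    fix x assume "x \<in> X"
    then show "x \<in> U" using X FV[OF X(1)] by (auto simp: U_def nbhd_def joined_def)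
  qed
  obtain u where u: "u \<in> S" using S by blast
  have "card U \<le> 1 + (\<Sum>X | X \<in> F \<and> X \<inter> S \<noteq> {}. card X - 1)"
  proof (rule card_connected_le)
    show "finite U" using UV fin finite_subset by blast
    show "finite {X \<in> F. X \<inter> S \<noteq> {}}" using fin by simp
    show "u \<in> U" using u by (simp add: U_def)
    show "X \<subseteq> U" if "X \<in> {X \<in> F. X \<inter> S \<noteq> {}}" for X using that touch by auto
  next
    fix T assume T: "u \<in> T" "T \<subset> U"
    show "\<exists>X\<in>{X \<in> F. X \<inter> S \<noteq> {}}. X \<inter> T \<noteq> {} \<and> \<not> X \<subseteq> T"
    proof (rule ccontr)
      assume "\<not> ?thesis"
      then have no: "\<And>X. X \<in> F \<Longrightarrow> X \<inter> S \<noteq> {} \<Longrightarrow> X \<inter> T \<noteq> {} \<Longrightarrow> X \<subseteq> T" by blast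
      \<comment> \<open>No feature touching \<open>S\<close> crosses the cut, so the two parts of
        \<open>S\<close> have disjoint neighbourhoods inside that of \<open>S\<close>. By minimality
        both parts expand, and adding the two inequalities contradicts the choice of
        \<open>S\<close>.\<close>
      have ns: "nbhd V F (S \<inter> T) \<subseteq> nbhd V F S \<inter> T" "nbhd V F (S - T) \<subseteq> nbhd V F S - T"
        using no unfolding nbhd_def joined_def by blast+
      have SmT: "S - T \<noteq> {}"
      proof
        assume ST: "S - T = {}"
        then obtain x where x: "x \<in> nbhd V F S" "x \<notin> T" using T unfolding U_def by blast
        then show False using no ST unfolding nbhd_def joined_def by blast
      qed
      have sm: "card (S \<inter> T) < card S" "card (S - T) < card S"
        using SmT u T finS by (auto intro!: psubset_card_mono)
      have "card (S \<inter> T) \<le> card (nbhd V F (S \<inter> T))"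
        using min[of "S \<inter> T"] sm(1) S u T by (force intro: leI)
      moreover have "card (S - T) \<le> card (nbhd V F (S - T))"
        using min[of "S - T"] sm(2) S SmT by (force intro: leI)
      moreover have "card (nbhd V F (S \<inter> T)) \<le> card (nbhd V F S \<inter> T)"
        "card (nbhd V F (S - T)) \<le> card (nbhd V F S - T)"
        using ns finN by (auto intro!: card_mono)
      moreover have "card S = card (S \<inter> T) + card (S - T)"
        using finS by (metis card_Diff_subset_Int card_mono finite_Int inf_le1 le_add_diff_inverse)
      moreover have "card (nbhd V F S) = card (nbhd V F S \<inter> T) + card (nbhd V F S - T)"
        using finN by (metis card_Diff_subset_Int card_mono finite_Int inf_le1 le_add_diff_inverse)
      ultimately show False using S by linarith
    qed
  qed
  moreover have "card U < 2 * card S"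
    using card_Un_le[of S "nbhd V F S"] S by (auto simp: U_def)
  ultimately show ?thesis
    using that[of S U] S UV touch by (auto simp: U_def)
qed

text \<open>In an optimal pairing no feature contains two unpaired vertices, so assigning to each
  unpaired vertex a feature containing it is injective.\<close>

lemma deficiency_le_length:
  assumes fin: "finite V" and cov: "V \<subseteq> \<Union>(set Xs)"
  shows "deficiency V (set Xs) \<le> length Xs"
proof -
  obtain f where f: "pairing V (set Xs) f" "card (unpaired V f) = deficiency V (set Xs)"
    using deficiency_attained by metis
  have "\<forall>v\<in>unpaired V f. \<exists>X\<in>set Xs. v \<in> X" using cov by (auto simp: unpaired_def)
  then obtain c where c: "\<And>v. v \<in> unpaired V f \<Longrightarrow> c v \<in> set Xs \<and> v \<in> c v" by metis
  have "inj_on c (unpaired V f)"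
  proof (rule inj_onI, rule ccontr)
    fix u v assume uv: "u \<in> unpaired V f" "v \<in> unpaired V f" "c u = c v" "u \<noteq> v"
    then have "joined (set Xs) u v" using c by (auto simp: joined_def)
    then show False using pairing_augment[OF fin f(1) uv(1,2)] f(2) by simp
  qed
  then have "card (unpaired V f) \<le> card (set Xs)"
    using c by (intro card_inj_on_le) auto
  then show ?thesis using f(2) card_length[of Xs] by simp
qed

section \<open>From families of sets back to graphs\<close>

definition clique_union :: "'a set \<Rightarrow> 'a set set \<Rightarrow> 'a graph" where
  "clique_union V F = (V, {{u, v} | u v. u \<in> V \<and> v \<in> V \<and> joined F u v})"

text \<open>Dual view: instead of the features of a vertex, record the vertices of a feature; every
  feature contributes a clique.\<close>

lemma intersection_graph_eq_clique_union:
  assumes "\<And>v. v \<in> V \<Longrightarrow> W v \<subseteq> M"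
  shows "intersection_graph V W = clique_union V ((\<lambda>w. {v \<in> V. w \<in> W v}) ` M)"
proof -
  have "u \<noteq> v \<and> W u \<inter> W v \<noteq> {} \<longleftrightarrow> joined ((\<lambda>w. {v \<in> V. w \<in> W v}) ` M) u v"
    if "u \<in> V" "v \<in> V" for u v
    using assms[OF that(1)] that by (auto simp: joined_def)
  then have "(u \<in> V \<and> v \<in> V \<and> u \<noteq> v \<and> W u \<inter> W v \<noteq> {}) =
      (u \<in> V \<and> v \<in> V \<and> joined ((\<lambda>w. {v \<in> V. w \<in> W v}) ` M) u v)" for u v
    by blast
  then show ?thesis by (simp only: intersection_graph_def clique_union_def)
qed

lemma perfect_matching_imp_joined:
  assumes "has_perfect_matching (clique_union V F)" "v \<in> V"
  shows "\<exists>u\<in>V. joined F v u"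
proof -
  obtain M where M: "M \<subseteq> {{u, v} | u v. u \<in> V \<and> v \<in> V \<and> joined F u v}" "\<Union>M = V"
    using assms(1) by (auto simp: has_perfect_matching_def is_matching_def clique_union_def)
  then obtain e where e: "e \<in> M" "v \<in> e" using assms(2) by blast
  then obtain a b where "e = {a, b}" "a \<in> V" "b \<in> V" "joined F a b" using M(1) by blast
  then show ?thesis using e(2) joined_sym[of F a b] by auto
qed

lemma perfect_matching_if_deficiency_0:
  assumes fin: "finite V" and d: "deficiency V F = 0"
  shows "has_perfect_matching (clique_union V F)"
proof -
  obtain f where f: "pairing V F f" "card (unpaired V f) = 0"
    using deficiency_attained d by metis
  then have U: "unpaired V f = {}" using fin by (simp add: unpaired_def)
  have fx: "f x \<in> V" "f (f x) = x" "joined F x (f x)" if "x \<in> V" for x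
    using f(1) U that by (auto simp: pairing_def unpaired_def)
  let ?M = "(\<lambda>x. {x, f x}) ` V"
  have "{x, f x} \<inter> {y, f y} = {}" if "x \<in> V" "y \<in> V" "{x, f x} \<noteq> {y, f y}" for x y
  proof (rule ccontr)
    assume "{x, f x} \<inter> {y, f y} \<noteq> {}"
    then consider "x = y" | "x = f y" | "f x = y" | "f x = f y" by blast
    then have "{x, f x} = {y, f y}"
      by cases (metis fx(2)[OF that(1)] fx(2)[OF that(2)] insert_commute)+
    then show False using that(3) by contradiction
  qed
  then have "pairwise disjnt ?M"
    unfolding pairwise_image pairwise_def disjnt_def by blast
  moreover have "?M \<subseteq> snd (clique_union V F)"
    unfolding clique_union_def snd_conv using fx(1,3) by blast
  moreover have "\<Union>?M = V" using fx(1) by auto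
  ultimately show ?thesis
    unfolding has_perfect_matching_def is_matching_def by (auto simp: clique_union_def)
qed

section \<open>Random features\<close>

text \<open>The law of the vertex set of a single feature.\<close>

definition random_subset :: "'a set \<Rightarrow> real \<Rightarrow> 'a set pmf" where
  "random_subset V p = map_pmf (\<lambda>b. {v \<in> V. b v}) (Pi_pmf V False (\<lambda>_. bernoulli_pmf p))"

abbreviation expect :: "'a pmf \<Rightarrow> ('a \<Rightarrow> real) \<Rightarrow> real" where
  "expect \<equiv> measure_pmf.expectation"

lemma set_random_subset: "finite V \<Longrightarrow> set_pmf (random_subset V p) \<subseteq> Pow V"
  by (auto simp: random_subset_def)

lemma finite_set_random_subset [simp]: "finite V \<Longrightarrow> finite (set_pmf (random_subset V p))"
  by (meson finite_Pow_iff finite_subset set_random_subset)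

lemma finite_set_replicate_pmf [simp]:
  "finite (set_pmf P) \<Longrightarrow> finite (set_pmf (replicate_pmf m P))"
  by (induction m) auto

lemma integrable_finite [simp]: "finite (set_pmf P) \<Longrightarrow> integrable (measure_pmf P) (f :: _ \<Rightarrow> real)"
  by (rule integrable_measure_pmf_finite)

lemma expect_mono:
  "finite (set_pmf P) \<Longrightarrow> (\<And>x. x \<in> set_pmf P \<Longrightarrow> f x \<le> g x) \<Longrightarrow> expect P f \<le> expect P g"
  by (intro integral_mono_AE) (auto simp: AE_measure_pmf_iff)

lemma prob_eq_expect: "measure_pmf.prob P A = expect P (\<lambda>x. of_bool (x \<in> A))"
proof -
  have "(\<lambda>x. of_bool (x \<in> A)) = (indicator A :: _ \<Rightarrow> real)" by (auto simp: indicator_def)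
  then show ?thesis by simp
qed

lemma prob_le_expect:
  assumes "finite (set_pmf P)" "\<And>x. x \<in> set_pmf P \<Longrightarrow> 0 \<le> f x" "\<And>x. x \<in> set_pmf P \<Longrightarrow> x \<in> A \<Longrightarrow> 1 \<le> f x"
  shows "measure_pmf.prob P A \<le> expect P f"
  unfolding prob_eq_expect using assms by (intro expect_mono) (auto simp: of_bool_def)

lemma expect_cong: "(\<And>x. x \<in> set_pmf P \<Longrightarrow> f x = g x) \<Longrightarrow> expect P f = expect P g"
  by (intro integral_cong_AE) (auto simp: AE_measure_pmf_iff)

lemma expect_bind:
  assumes "finite (set_pmf P)" "\<And>x. x \<in> set_pmf P \<Longrightarrow> finite (set_pmf (f x))"
  shows "expect (P \<bind> f) h = expect P (\<lambda>x. expect (f x) h)"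
  by (subst pmf_expectation_bind[of "set_pmf P"])
    (use assms in \<open>auto simp: integral_measure_pmf[of "set_pmf P"]\<close>)

lemma expect_pair:
  assumes "finite (set_pmf P)" "finite (set_pmf Q)"
  shows "expect (pair_pmf P Q) h = expect P (\<lambda>x. expect Q (\<lambda>y. h (x, y)))"
  unfolding pair_pmf_def by (simp add: expect_bind assms)

lemma expect_replicate_Suc:
  "finite (set_pmf P) \<Longrightarrow>
    expect (replicate_pmf (Suc m) P) f = expect P (\<lambda>x. expect (replicate_pmf m P) (\<lambda>xs. f (x # xs)))"
  by (simp add: expect_bind)

lemma expect_replicate_prod:
  assumes "finite (set_pmf P)"
  shows "expect (replicate_pmf m P) (\<lambda>xs. \<Prod>x\<leftarrow>xs. g x) = expect P g ^ m"
  by (induction m) (simp_all add: expect_bind assms)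

lemma prob_replicate_all:
  assumes "finite (set_pmf P)"
  shows "measure_pmf.prob (replicate_pmf m P) {xs. \<forall>x\<in>set xs. x \<in> A} = measure_pmf.prob P A ^ m"
proof -
  have *: "of_bool (\<forall>x\<in>set xs. x \<in> A) = (\<Prod>x\<leftarrow>xs. of_bool (x \<in> A) :: real)" for xs
    by (induction xs) (simp_all add: of_bool_conj)
  show ?thesis by (simp add: prob_eq_expect * expect_replicate_prod assms)
qed

lemma expect_random_subset_prod:
  assumes "finite V" "p \<in> {0..1}" "\<And>v b. v \<in> V \<Longrightarrow> h v b \<ge> (0 :: real)"
  shows "expect (random_subset V p) (\<lambda>X. \<Prod>v\<in>V. h v (v \<in> X)) =
    (\<Prod>v\<in>V. p * h v True + (1 - p) * h v False)"
proof -
  have "expect (random_subset V p) (\<lambda>X. \<Prod>v\<in>V. h v (v \<in> X)) =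
      expect (Pi_pmf V False (\<lambda>_. bernoulli_pmf p)) (\<lambda>b. \<Prod>v\<in>V. h v (b v))"
    by (simp add: random_subset_def)
  also have "\<dots> = (\<Prod>v\<in>V. expect (bernoulli_pmf p) (h v))"
    using assms by (intro expectation_prod_Pi_pmf) auto
  also have "\<dots> = (\<Prod>v\<in>V. p * h v True + (1 - p) * h v False)"
    using assms(2) by (simp add: mult.commute)
  finally show ?thesis .
qed

lemma prod_of_bool:
  "finite A \<Longrightarrow> (\<Prod>x\<in>A. of_bool (P x)) = (of_bool (\<forall>x\<in>A. P x) :: real)"
  by (induction rule: finite_induct) (simp_all add: of_bool_conj)

lemma prob_random_subset_cylinder:
  assumes "finite V" "p \<in> {0..1}" "A \<subseteq> V" "B \<subseteq> V" "A \<inter> B = {}"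
  shows "measure_pmf.prob (random_subset V p) {X. A \<subseteq> X \<and> X \<inter> B = {}} = p ^ card A * (1 - p) ^ card B"
proof -
  let ?h = "\<lambda>v b. of_bool ((v \<in> A \<longrightarrow> b) \<and> (v \<in> B \<longrightarrow> \<not> b)) :: real"
  have fin: "finite A" "finite B" using assms finite_subset by blast+
  have "of_bool (A \<subseteq> X \<and> X \<inter> B = {}) = (\<Prod>v\<in>V. ?h v (v \<in> X))" for X
    using assms by (subst prod_of_bool) (auto simp del: of_bool_eq_iff intro!: arg_cong[where f = of_bool])
  then have "measure_pmf.prob (random_subset V p) {X. A \<subseteq> X \<and> X \<inter> B = {}} =
      expect (random_subset V p) (\<lambda>X. \<Prod>v\<in>V. ?h v (v \<in> X))"
    by (simp only: prob_eq_expect mem_Collect_eq)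
  also have "\<dots> = (\<Prod>v\<in>V. p * ?h v True + (1 - p) * ?h v False)"
    by (rule expect_random_subset_prod[OF assms(1,2), of ?h]) simp
  also have "\<dots> = (\<Prod>v\<in>V. (if v \<in> A then p else 1) * (if v \<in> B then 1 - p else 1))"
    using assms by (intro prod.cong) auto
  also have "\<dots> = p ^ card A * (1 - p) ^ card B"
    using assms by (simp add: prod.distrib flip: prod.inter_restrict) (simp add: Int_absorb1)
  finally show ?thesis .
qed

section \<open>Splitting the randomness into independent rounds\<close>

lemma bernoulli_or:
  assumes "a \<in> {0..1}" "b \<in> {0..1}"
  shows "bernoulli_pmf (a + b - a * b) =
    bernoulli_pmf a \<bind> (\<lambda>x. bernoulli_pmf b \<bind> (\<lambda>y. return_pmf (x \<or> y)))" (is "?l = ?r")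
proof (rule pmf_eqI)
  fix i
  have ab: "0 \<le> a + b - a * b" "a + b - a * b \<le> 1"
  proof -
    have "0 \<le> (1 - a) * (1 - b)" "0 \<le> b * (1 - a)" using assms by auto
    then show "0 \<le> a + b - a * b" "a + b - a * b \<le> 1" using assms by (auto simp: algebra_simps)
  qed
  show "pmf ?l i = pmf ?r i"
    using assms ab by (cases i) (simp_all add: pmf_bind measure_pmf_single field_simps)
qed

text \<open>\<open>a + b - a * b\<close> is \<open>1 - (1 - a) * (1 - b)\<close>: a vertex is
  present if at least one of two independent rounds selects it.\<close>

lemma random_subset_or:
  assumes "finite V" "a \<in> {0..1}" "b \<in> {0..1}"
  shows "random_subset V (a + b - a * b) =
    map_pmf (\<lambda>(X, Y). X \<union> Y) (pair_pmf (random_subset V a) (random_subset V b))"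
proof -
  let ?P = "\<lambda>q. Pi_pmf V False (\<lambda>_. bernoulli_pmf q)"
  have "?P (a + b - a * b) = ?P a \<bind> (\<lambda>f. ?P b \<bind> (\<lambda>g. return_pmf (\<lambda>v. v \<in> V \<and> (f v \<or> g v))))"
    unfolding bernoulli_or[OF assms(2,3)]
    by (subst Pi_pmf_bind[where d' = False], use assms in simp,
        subst Pi_pmf_bind[where d' = False], use assms in simp)
      (auto simp: Pi_pmf_return_pmf assms intro!: bind_pmf_cong arg_cong[where f = return_pmf])
  then show ?thesis
    unfolding random_subset_def
    by (simp add: map_pmf_def pair_pmf_def bind_assoc_pmf bind_return_pmf)
      (intro bind_pmf_cong refl arg_cong[where f = return_pmf], auto)
qed

lemma random_subset_Un:
  assumes "finite A" "finite B" "A \<inter> B = {}"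
  shows "random_subset (A \<union> B) p =
    map_pmf (\<lambda>(X, Y). X \<union> Y) (pair_pmf (random_subset A p) (random_subset B p))"
  unfolding random_subset_def Pi_pmf_union[OF assms]
  by (simp add: map_pmf_def pair_pmf_def bind_assoc_pmf bind_return_pmf case_prod_beta)
    (intro bind_pmf_cong refl arg_cong[where f = return_pmf], use assms in auto)

lemma replicate_map_pair:
  "replicate_pmf m (map_pmf f (pair_pmf P Q)) =
    map_pmf (\<lambda>(xs, ys). map f (zip xs ys)) (pair_pmf (replicate_pmf m P) (replicate_pmf m Q))"
proof (induction m)
  case 0
  then show ?case by (simp add: map_pmf_def pair_pmf_def bind_return_pmf)
next
  case (Suc m)
  have "replicate_pmf (Suc m) (map_pmf f (pair_pmf P Q)) =
     do {x \<leftarrow> P; y \<leftarrow> Q; xs \<leftarrow> replicate_pmf m P; ys \<leftarrow> replicate_pmf m Q;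
         return_pmf (f (x, y) # map f (zip xs ys))}"
    unfolding replicate_pmf.simps Suc
    by (simp add: map_pmf_def pair_pmf_def bind_return_pmf bind_assoc_pmf)
  also have "\<dots> = do {x \<leftarrow> P; xs \<leftarrow> replicate_pmf m P; y \<leftarrow> Q; ys \<leftarrow> replicate_pmf m Q;
         return_pmf (f (x, y) # map f (zip xs ys))}"
    by (subst bind_commute_pmf[of Q]) simp
  finally show ?case
    by (simp add: map_pmf_def pair_pmf_def bind_return_pmf bind_assoc_pmf)
qed

text \<open>Grouping the independent entries by feature gives independent, identically distributed
  vertex sets. A list keeps equal vertex sets of different features as separate trials.\<close>

lemma random_intersection_graph_eq:
  "random_intersection_graph n m p =
    map_pmf (\<lambda>Xs. clique_union {..<n} (set Xs)) (replicate_pmf m (random_subset {..<n} p))"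
proof -
  let ?P = "\<lambda>A. Pi_pmf A False (\<lambda>_. bernoulli_pmf p)"
  \<comment> \<open>Reversed, so that the new feature \<open>m\<close> comes first and matches the
    cons in \<open>replicate_pmf\<close>.\<close>
  let ?sets = "\<lambda>m B. map (\<lambda>w. {v \<in> {..<n}. B (v, w)}) (rev [0..<m])"
  have "replicate_pmf m (random_subset {..<n} p) = map_pmf (?sets m) (?P ({..<n} \<times> {..<m}))" for m
  proof (induction m)
    case 0
    then show ?case by simp
  next
    case (Suc m)
    have U: "{..<n} \<times> {..<Suc m} = {..<n} \<times> {m} \<union> {..<n} \<times> {..<m}" by auto
    have bij: "?P {..<n} = map_pmf (\<lambda>g v. if v < n then g (v, m) else False) (?P ({..<n} \<times> {m}))"
    proof -
      \<comment> \<open>Indices outside \<open>{..<n}\<close> must be sent outside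
        \<open>{..<n} \<times> {m}\<close>, where the product law takes its default value
        \<open>False\<close>.\<close>
      let ?h = "\<lambda>v. if v < n then (v, m) else (n, Suc m)"
      have "?P {..<n} = map_pmf (\<lambda>g. g \<circ> ?h) (?P ({..<n} \<times> {m}))"
        by (rule Pi_pmf_bij_betw) (auto simp: bij_betw_def inj_on_def image_def)
      also have "\<dots> = map_pmf (\<lambda>g v. if v < n then g (v, m) else False) (?P ({..<n} \<times> {m}))"
        by (intro map_pmf_cong refl ext) (auto simp: set_Pi_pmf PiE_dflt_def)
      finally show ?thesis .
    qed
    have "map_pmf (?sets (Suc m)) (?P ({..<n} \<times> {..<Suc m})) =
       do {f \<leftarrow> ?P ({..<n} \<times> {m}); g \<leftarrow> ?P ({..<n} \<times> {..<m});
           return_pmf ({v \<in> {..<n}. f (v, m)} # ?sets m g)}"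
      unfolding U by (subst Pi_pmf_union)
        (auto simp: map_pmf_def pair_pmf_def bind_assoc_pmf bind_return_pmf
          intro!: bind_pmf_cong refl arg_cong[where f = return_pmf])
    also have "\<dots> = replicate_pmf (Suc m) (random_subset {..<n} p)"
      unfolding replicate_pmf.simps Suc unfolding random_subset_def bij
      by (simp add: map_pmf_def bind_assoc_pmf bind_return_pmf cong: conj_cong)
    finally show ?case ..
  qed
  note this[of m]
  moreover have "intersection_graph {..<n} (\<lambda>v. {w \<in> {..<m}. B (v, w)}) =
      clique_union {..<n} (set (?sets m B))" for B
    by (subst intersection_graph_eq_clique_union[of _ _ "{..<m}"])
      (auto intro!: arg_cong[where f = "clique_union {..<n}"])
  ultimately show ?thesis
    by (simp add: random_intersection_graph_def pmf.map_comp o_def)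
qed

section \<open>Sprinkling random features onto an expander\<close>

lemma prob_random_subset_hit:
  assumes "finite V" "p \<in> {0..1}" "T \<subseteq> V"
  shows "measure_pmf.prob (random_subset V p) {X. X \<inter> T \<noteq> {}} = 1 - (1 - p) ^ card T"
proof -
  have "{X. X \<inter> T \<noteq> {}} = UNIV - {X. {} \<subseteq> X \<and> X \<inter> T = {}}" by auto
  then show ?thesis
    using measure_pmf.prob_compl[of "{X. {} \<subseteq> X \<and> X \<inter> T = {}}" "random_subset V p"]
      prob_random_subset_cylinder[OF assms(1,2), of "{}" T] assms(3) by simp
qed

text \<open>Two-stage exposure: first the feature is revealed on a set \<open>A'\<close> of
  \<open>h\<close> vertices of \<open>A\<close>. Once some \<open>a\<close> there is hit,
  \<open>B a\<close> still has at least \<open>h\<close> unrevealed elements because it started with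
  \<open>2 * h\<close>, so two independent hits suffice.\<close>

lemma prob_random_subset_booster:
  assumes fin: "finite V" and p: "p \<in> {0..1}" and A: "A \<subseteq> V" "2 * h \<le> card A"
    and B: "\<And>a. a \<in> A \<Longrightarrow> B a \<subseteq> V \<and> 2 * h \<le> card (B a)"
  shows "(1 - (1 - p) ^ h)\<^sup>2 \<le> measure_pmf.prob (random_subset V p) {X. \<exists>a\<in>A. \<exists>b\<in>B a. a \<in> X \<and> b \<in> X}"
proof -
  obtain A' where A': "A' \<subseteq> A" "card A' = h" "finite A'"
    using obtain_subset_with_card_n[of h A] A(2) by auto
  have A'V: "A' \<subseteq> V" using A' A by blast
  let ?W = "V - A'" and ?G = "\<lambda>X. \<exists>a\<in>A. \<exists>b\<in>B a. a \<in> X \<and> b \<in> X" and ?r = "1 - (1 - p) ^ h"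
  have r: "0 \<le> ?r" using p by (simp add: power_le_one)
  have V: "random_subset V p = map_pmf (\<lambda>(X, Y). X \<union> Y) (pair_pmf (random_subset A' p) (random_subset ?W p))"
    using random_subset_Un[of A' ?W p] A'(3) fin A'V by (simp add: Un_absorb1)
  have inner: "of_bool (X \<inter> A' \<noteq> {}) * ?r \<le> expect (random_subset ?W p) (\<lambda>Y. of_bool (?G (X \<union> Y)))" for X
  proof (cases "X \<inter> A' = {}")
    case True
    then show ?thesis by simp
  next
    case False
    then obtain a where a: "a \<in> X" "a \<in> A'" by blast
    then have "a \<in> A" using A'(1) by blast
    let ?T = "B a - A'"
    have "card (B a) - card A' \<le> card ?T" using A'(3) by (intro diff_card_le_card_Diff)
    then have hT: "h \<le> card ?T" using B[OF \<open>a \<in> A\<close>] A'(2) by linarith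
    have "?r \<le> 1 - (1 - p) ^ card ?T"
      using power_decreasing[OF hT, of "1 - p"] p by simp
    also have "\<dots> = expect (random_subset ?W p) (\<lambda>Y. of_bool (Y \<inter> ?T \<noteq> {}))"
      using prob_random_subset_hit[OF _ p, of ?W ?T] fin B[OF \<open>a \<in> A\<close>]
      unfolding prob_eq_expect by (simp add: Diff_mono)
    also have "\<dots> \<le> expect (random_subset ?W p) (\<lambda>Y. of_bool (?G (X \<union> Y)))"
      using a(1) \<open>a \<in> A\<close> fin by (intro expect_mono) (auto simp: of_bool_def)
    finally show ?thesis using False by simp
  qed
  have "?r\<^sup>2 = expect (random_subset A' p) (\<lambda>X. of_bool (X \<inter> A' \<noteq> {}) * ?r)"
    using prob_random_subset_hit[of A' p A'] A' p unfolding prob_eq_expect by (simp add: power2_eq_square)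
  also have "\<dots> \<le> expect (random_subset A' p)
      (\<lambda>X. expect (random_subset ?W p) (\<lambda>Y. of_bool (?G (X \<union> Y))))"
    by (intro expect_mono inner) (use A' in auto)
  also have "\<dots> = measure_pmf.prob (random_subset V p) {X. ?G X}"
    unfolding prob_eq_expect V using A' fin by (simp add: expect_pair case_prod_beta)
  finally show ?thesis .
qed

text \<open>Every further random feature joins a pair that lowers the deficiency by two with probability
  at least \<open>q\<close>, so \<open>2 ^ deficiency\<close> shrinks in expectation by the factor \<open>1 - 3 * q / 4\<close>.\<close>

lemma prob_deficiency_sprinkle:
  fixes p :: real
  assumes fin: "finite V" "even (card V)" and p: "p \<in> {0..1}" and "expander V F"
  defines "q \<equiv> (1 - (1 - p) ^ (card V div 32))\<^sup>2"
  shows "measure_pmf.prob (replicate_pmf N (random_subset V p)) {Ys. deficiency V (set Ys \<union> F) > 0}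
    \<le> 2 ^ deficiency V F * (1 - 3 * q / 4) ^ N"
  using assms(4)
proof (induction N arbitrary: F)
  case 0
  then show ?case by (simp add: prob_eq_expect)
next
  case (Suc N)
  let ?R = "random_subset V p" and ?c = "1 - 3 * q / 4" and ?d = "deficiency V F"
  have q: "0 \<le> q" "q \<le> 1"
    using p by (auto simp: q_def power_le_one intro!: power_le_one)
  have c: "0 \<le> ?c" using q by simp
  show ?case
  proof (cases "?d = 0")
    case True
    then have "deficiency V (set Ys \<union> F) = 0" for Ys
      using deficiency_antimono[of F "set Ys \<union> F" V] by simp
    then show ?thesis using c by (simp add: zero_le_mult_iff)
  next
    case False
    then obtain A B where AB: "A \<subseteq> V" "card V < 16 * card A"
      "\<And>a. a \<in> A \<Longrightarrow> B a \<subseteq> V \<and> card V < 16 * card (B a)"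
      "\<And>a b X. a \<in> A \<Longrightarrow> b \<in> B a \<Longrightarrow> a \<in> X \<Longrightarrow> b \<in> X \<Longrightarrow>
         deficiency V (insert X F) + 2 \<le> ?d"
      using boosters[OF fin Suc.prems] by blast
    let ?G = "\<lambda>X. \<exists>a\<in>A. \<exists>b\<in>B a. a \<in> X \<and> b \<in> X"
    have G: "q \<le> expect ?R (\<lambda>X. of_bool (?G X))"
      using prob_random_subset_booster[OF fin(1) p AB(1), of "card V div 32" B] AB(2,3)
      unfolding q_def prob_eq_expect by force
    \<comment> \<open>A success lowers the exponent by two, leaving at most a quarter of the power;
      hence the loss 3 / 4.\<close>
    have dX: "(2 :: real) ^ deficiency V (insert X F) \<le> 2 ^ ?d * (1 - 3 / 4 * of_bool (?G X))" for X
    proof (cases "?G X")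
      case True
      then have "deficiency V (insert X F) + 2 \<le> ?d" using AB(4) by blast
      then have "(2 :: real) ^ (deficiency V (insert X F) + 2) \<le> 2 ^ ?d"
        by (intro power_increasing) auto
      then show ?thesis using True by simp
    next
      case False
      have "deficiency V (insert X F) \<le> ?d" by (intro deficiency_antimono) auto
      moreover have "of_bool (?G X) = (0 :: real)" using False by (rule of_bool_eq_0_iff[THEN iffD2])
      ultimately show ?thesis by (simp only:) (simp add: power_increasing)
    qed
    have "measure_pmf.prob (replicate_pmf (Suc N) ?R) {Ys. deficiency V (set Ys \<union> F) > 0} =
        expect ?R (\<lambda>X. measure_pmf.prob (replicate_pmf N ?R) {Ys. deficiency V (set Ys \<union> insert X F) > 0})"
      unfolding prob_eq_expect using fin by (simp add: expect_replicate_Suc del: replicate_pmf.simps)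
    also have "\<dots> \<le> expect ?R (\<lambda>X. 2 ^ deficiency V (insert X F) * ?c ^ N)"
      by (intro expect_mono Suc.IH expander_mono[OF fin(1) _ Suc.prems]) (use fin in auto)
    also have "\<dots> \<le> expect ?R (\<lambda>X. 2 ^ ?d * (1 - 3 / 4 * of_bool (?G X)) * ?c ^ N)"
      by (intro expect_mono mult_right_mono dX) (use fin c in auto)
    also have "\<dots> = 2 ^ ?d * (1 - 3 / 4 * expect ?R (\<lambda>X. of_bool (?G X))) * ?c ^ N"
      using fin by simp
    also have "\<dots> \<le> 2 ^ ?d * ?c * ?c ^ N"
      by (intro mult_right_mono mult_left_mono) (use G c in auto)
    finally show ?thesis by (simp add: mult_ac)
  qed
qed

lemma joined_map_Un:
  assumes "length Xs = length Ys" "joined (set Xs \<union> set Ys) u v"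
  shows "joined (set (map (\<lambda>(X, Y). X \<union> Y) (zip Xs Ys))) u v"
proof -
  obtain i where "i < length Xs" "u \<in> Xs ! i \<and> v \<in> Xs ! i \<or> u \<in> Ys ! i \<and> v \<in> Ys ! i" "u \<noteq> v"
    using assms unfolding joined_def by (metis UnE in_set_conv_nth)
  then show ?thesis
    unfolding joined_def set_conv_nth using assms(1) by (auto intro!: exI[of _ "Xs ! i \<union> Ys ! i"] exI[of _ i])
qed

text \<open>The merged feature \<open>X \<union> Y\<close> also joins vertices of \<open>X\<close>
  to vertices of \<open>Y\<close>; forgetting these mixed pairs can only raise the deficiency, hence
  an inequality.\<close>

lemma prob_deficiency_or:
  assumes "finite V" "a \<in> {0..1}" "b \<in> {0..1}"
  shows "measure_pmf.prob (replicate_pmf m (random_subset V (a + b - a * b))) {Zs. deficiency V (set Zs) > 0}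
    \<le> measure_pmf.prob (pair_pmf (replicate_pmf m (random_subset V a)) (replicate_pmf m (random_subset V b)))
        {(Xs, Ys). deficiency V (set Xs \<union> set Ys) > 0}"
proof -
  have "deficiency V (set (map (\<lambda>(X, Y). X \<union> Y) (zip Xs Ys))) \<le> deficiency V (set Xs \<union> set Ys)"
    if "length Xs = length Ys" for Xs Ys :: "'a set list"
    by (rule deficiency_antimono_joined) (rule joined_map_Un[OF that])
  note le = this
  let ?PQ = "pair_pmf (replicate_pmf m (random_subset V a)) (replicate_pmf m (random_subset V b))"
  have "of_bool (0 < deficiency V (set (map (\<lambda>(X, Y). X \<union> Y) (zip (fst z) (snd z)))))
      \<le> (of_bool (0 < deficiency V (set (fst z) \<union> set (snd z))) :: real)" if "z \<in> set_pmf ?PQ" for z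
    using that le[of "fst z" "snd z"] by (auto simp: set_replicate_pmf)
  then have "expect ?PQ (\<lambda>z. of_bool (0 < deficiency V (set (map (\<lambda>(X, Y). X \<union> Y) (zip (fst z) (snd z))))))
      \<le> expect ?PQ (\<lambda>z. of_bool (0 < deficiency V (set (fst z) \<union> set (snd z))))"
    by (intro expect_mono) (simp_all add: assms(1))
  then show ?thesis
    unfolding prob_eq_expect random_subset_or[OF assms] replicate_map_pair integral_map_pmf
    by (simp only: case_prod_beta mem_Collect_eq)
qed

text \<open>Coupling: \<open>p\<close> is reached from \<open>a\<close> by a second independent
  round, which is then discarded. The case \<open>a = 1\<close> is separate because \<open>b\<close>
  divides by \<open>1 - a\<close>.\<close>

lemma prob_deficiency_antimono:
  assumes fin: "finite V" and ab: "0 \<le> a" "a \<le> p" "p \<le> 1"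
  shows "measure_pmf.prob (replicate_pmf m (random_subset V p)) {Zs. deficiency V (set Zs) > 0}
    \<le> measure_pmf.prob (replicate_pmf m (random_subset V a)) {Zs. deficiency V (set Zs) > 0}"
proof (cases "a = 1")
  case True
  then show ?thesis using ab by simp
next
  case False
  define b where "b = (p - a) / (1 - a)"
  have b: "b \<in> {0..1}" using ab False by (auto simp: b_def field_simps)
  have "b * (1 - a) = p - a" using False by (simp add: b_def)
  then have p: "p = a + b - a * b" by (simp add: algebra_simps)
  let ?P = "replicate_pmf m (random_subset V a)" and ?Q = "replicate_pmf m (random_subset V b)"
  have "measure_pmf.prob (replicate_pmf m (random_subset V p)) {Zs. deficiency V (set Zs) > 0}
    \<le> measure_pmf.prob (pair_pmf ?P ?Q) {(Xs, Ys). deficiency V (set Xs \<union> set Ys) > 0}"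
    unfolding p by (rule prob_deficiency_or) (use fin ab b in auto)
  also have "\<dots> \<le> measure_pmf.prob (pair_pmf ?P ?Q) (fst -` {Xs. deficiency V (set Xs) > 0})"
    by (intro measure_pmf.finite_measure_mono)
      (auto intro: less_le_trans[OF _ deficiency_antimono[OF Un_upper1]])
  also have "\<dots> = measure_pmf.prob ?P {Xs. deficiency V (set Xs) > 0}"
    by (metis map_fst_pair_pmf measure_map_pmf)
  finally show ?thesis .
qed

lemma replicate_pmf_add:
  "replicate_pmf (k + l) P = map_pmf (\<lambda>(xs, ys). xs @ ys) (pair_pmf (replicate_pmf k P) (replicate_pmf l P))"
  by (simp add: replicate_pmf_distrib map_pmf_def pair_pmf_def bind_assoc_pmf bind_return_pmf)

text \<open>Conditioning on the first round: failure of expansion is charged to the first term,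
  otherwise sprinkling starts from a deficiency of at most \<open>D\<close>. The law
  \<open>P\<close> is general because one regime uses all m features at a smaller probability and
  the other uses fewer features.\<close>

lemma prob_deficiency_two_rounds:
  fixes b :: real
  assumes fin: "finite V" "even (card V)" and b: "b \<in> {0..1}" 
    and D: "\<And>Xs. Xs \<in> set_pmf P \<Longrightarrow> expander V (set Xs) \<Longrightarrow> deficiency V (set Xs) \<le> D"
    and P: "finite (set_pmf P)"
  defines "q \<equiv> (1 - (1 - b) ^ (card V div 32))\<^sup>2"
  shows "measure_pmf.prob (pair_pmf P (replicate_pmf l (random_subset V b)))
      {(Xs, Ys). deficiency V (set Xs \<union> set Ys) > 0}
    \<le> measure_pmf.prob P {Xs. \<not> expander V (set Xs)} + 2 ^ D * (1 - 3 * q / 4) ^ l"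
proof -
  let ?Q = "replicate_pmf l (random_subset V b)" and ?c = "(1 - 3 * q / 4) ^ l"
  have q: "0 \<le> q" "q \<le> 1"
    using b by (auto simp: q_def power_le_one intro!: power_le_one)
  have c: "0 \<le> ?c" using q by simp
  have "expect ?Q (\<lambda>Ys. of_bool (deficiency V (set Xs \<union> set Ys) > 0)) \<le>
      of_bool (\<not> expander V (set Xs)) + 2 ^ D * ?c" if Xs: "Xs \<in> set_pmf P" for Xs
  proof (cases "expander V (set Xs)")
    case True
    have "expect ?Q (\<lambda>Ys. of_bool (deficiency V (set Xs \<union> set Ys) > 0)) \<le> 2 ^ deficiency V (set Xs) * ?c"
      using prob_deficiency_sprinkle[OF fin b True, of l]
      unfolding prob_eq_expect q_def by (simp add: Un_commute)
    also have "\<dots> \<le> 2 ^ D * ?c"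
      by (intro mult_right_mono power_increasing D Xs True c) auto
    finally show ?thesis using True by simp
  next
    case False
    have "expect ?Q (\<lambda>Ys. of_bool (deficiency V (set Xs \<union> set Ys) > 0)) \<le> expect ?Q (\<lambda>_. 1)"
      by (intro expect_mono) (use fin in auto)
    moreover have "0 \<le> 2 ^ D * ?c" using c by simp
    ultimately show ?thesis using False by simp
  qed
  then have "expect P (\<lambda>Xs. expect ?Q (\<lambda>Ys. of_bool (deficiency V (set Xs \<union> set Ys) > 0))) \<le>
      expect P (\<lambda>Xs. of_bool (\<not> expander V (set Xs)) + 2 ^ D * ?c)"
    by (intro expect_mono P)
  also have "\<dots> = expect P (\<lambda>Xs. of_bool (\<not> expander V (set Xs))) + 2 ^ D * ?c"
    using P by simp
  finally show ?thesis
    unfolding prob_eq_expect using fin P by (simp add: expect_pair)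
qed

text \<open>Chebyshev for the number of isolated vertices, where \<open>q\<close> is the probability
  that one feature gives a fixed vertex no neighbour. By inclusion-exclusion a feature can give
  neighbours to both of two vertices only by containing both, so correlation costs at most
  \<open>p\<^sup>2\<close> per feature.\<close>

lemma prob_no_isolated:
  fixes p q :: real and n :: nat
  assumes p: "p \<in> {0..1}"
  defines "q \<equiv> 1 - p * (1 - (1 - p) ^ (n - 1))"
  assumes q: "q > 0" and n: "n > 0"
  shows "measure_pmf.prob (replicate_pmf m (random_subset {..<n} p))
      {Xs. \<forall>v<n. \<exists>u<n. joined (set Xs) v u}
    \<le> 1 / (n * q ^ m) + (1 + p\<^sup>2 / q\<^sup>2) ^ m - 1"
proof -
  let ?V = "{..<n}" and ?good = "\<lambda>v X. \<not> (v \<in> X \<and> X \<noteq> {v})"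
  let ?R = "random_subset ?V p"
  let ?P = "replicate_pmf m ?R"
  define I where "I v Xs = (of_bool (\<forall>X\<in>set Xs. ?good v X) :: real)" for v :: nat and Xs
  define N where "N Xs = (\<Sum>v<n. I v Xs)" for Xs
  define \<mu> where "\<mu> = n * q ^ m"
  have mu: "\<mu> > 0" using n q by (simp add: \<mu>_def)
  have cyl: "expect ?R (\<lambda>X. of_bool (A \<subseteq> X \<and> X \<inter> B = {})) = p ^ card A * (1 - p) ^ card B"
    if "A \<subseteq> ?V" "B \<subseteq> ?V" "A \<inter> B = {}" for A B
    using prob_random_subset_cylinder[OF _ p that] by (simp add: prob_eq_expect)
  have sub: "X \<subseteq> ?V" if "X \<in> set_pmf ?R" for X using that set_random_subset[of ?V p] by auto
  have bad: "expect ?R (\<lambda>X. of_bool (v \<in> X \<and> X \<noteq> {v})) = 1 - q" if v: "v < n" for v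
  proof -
    have "expect ?R (\<lambda>X. of_bool (v \<in> X \<and> X \<noteq> {v})) =
       expect ?R (\<lambda>X. of_bool ({v} \<subseteq> X \<and> X \<inter> {} = {}) - of_bool ({v} \<subseteq> X \<and> X \<inter> (?V - {v}) = {}))"
      using sub by (intro integral_cong_AE) (auto simp: AE_measure_pmf_iff of_bool_def)
    also have "\<dots> = expect ?R (\<lambda>X. of_bool ({v} \<subseteq> X \<and> X \<inter> {} = {}))
        - expect ?R (\<lambda>X. of_bool ({v} \<subseteq> X \<and> X \<inter> (?V - {v}) = {}))"
      by (rule Bochner_Integration.integral_diff) simp_all
    also have "\<dots> = p - p * (1 - p) ^ (n - 1)"
      using cyl[of "{v}" "{}"] cyl[of "{v}" "?V - {v}"] v by simp
    finally show ?thesis by (simp add: q_def algebra_simps)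
  qed
  have pair: "expect ?R (\<lambda>X. of_bool (?good u X \<and> ?good v X)) \<le> q\<^sup>2 + p\<^sup>2" if uv: "u < n" "v < n" "u \<noteq> v" for u v
  proof -
    have "expect ?R (\<lambda>X. of_bool (?good u X \<and> ?good v X)) \<le>
       expect ?R (\<lambda>X. 1 - of_bool (u \<in> X \<and> X \<noteq> {u}) - of_bool (v \<in> X \<and> X \<noteq> {v})
         + of_bool ({u, v} \<subseteq> X \<and> X \<inter> {} = {}))"
      by (intro expect_mono) (auto simp: of_bool_def)
    also have "\<dots> = 1 - (1 - q) - (1 - q) + p\<^sup>2"
      using uv by (simp only: Bochner_Integration.integral_add Bochner_Integration.integral_diff
          integrable_finite finite_set_random_subset finite_lessThan bad cyl) 
        (use cyl[of "{u, v}" "{}"] uv in \<open>simp add: power2_eq_square\<close>)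
    also have "\<dots> \<le> q\<^sup>2 + p\<^sup>2" using zero_le_power2[of "1 - q"] by (simp add: power2_eq_square algebra_simps)
    finally show ?thesis .
  qed
  have I1: "expect ?P (I v) = q ^ m" if "v < n" for v
  proof -
    have "expect ?R (\<lambda>X. of_bool (?good v X)) = expect ?R (\<lambda>X. 1 - of_bool (v \<in> X \<and> X \<noteq> {v}))"
      by (intro arg_cong[where f = "expect ?R"]) (auto simp: of_bool_def)
    also have "\<dots> = q" using bad[OF that] by simp
    finally show ?thesis
      using prob_replicate_all[of ?R m "{X. ?good v X}"] by (simp add: prob_eq_expect I_def[abs_def])
  qed
  have I2: "expect ?P (\<lambda>Xs. I u Xs * I v Xs) \<le> (q\<^sup>2 + p\<^sup>2) ^ m" if "u < n" "v < n" "u \<noteq> v" for u v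
  proof -
    have "expect ?P (\<lambda>Xs. I u Xs * I v Xs) = (expect ?R (\<lambda>X. of_bool (?good u X \<and> ?good v X))) ^ m"
      using prob_replicate_all[of ?R m "{X. ?good u X \<and> ?good v X}"]
      by (simp add: prob_eq_expect I_def ball_conj_distrib flip: of_bool_conj)
    also have "\<dots> \<le> (q\<^sup>2 + p\<^sup>2) ^ m"
      by (intro power_mono pair that) (auto intro: Bochner_Integration.integral_nonneg)
    finally show ?thesis .
  qed
  have I_sq: "I v Xs * I v Xs = I v Xs" for v Xs by (auto simp: I_def)
  have EN: "expect ?P N = \<mu>"
    unfolding N_def using I1 by (subst Bochner_Integration.integral_sum) (auto simp: \<mu>_def)
  have "expect ?P (\<lambda>Xs. (N Xs)\<^sup>2) = (\<Sum>u<n. \<Sum>v<n. expect ?P (\<lambda>Xs. I u Xs * I v Xs))"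
    unfolding N_def power2_eq_square sum_product
    by (subst Bochner_Integration.integral_sum; simp)+
  also have "\<dots> \<le> (\<Sum>u<n. \<Sum>v<n. (if u = v then q ^ m else 0) + (q\<^sup>2 + p\<^sup>2) ^ m)"
  proof (intro sum_mono)
    fix u v assume "u \<in> {..<n}" "v \<in> {..<n}"
    then show "expect ?P (\<lambda>Xs. I u Xs * I v Xs) \<le> (if u = v then q ^ m else 0) + (q\<^sup>2 + p\<^sup>2) ^ m"
      using I1[of u] I2[of u v] by (cases "u = v") (auto simp: I_sq)
  qed
  also have "\<dots> = \<mu> + n\<^sup>2 * (q\<^sup>2 + p\<^sup>2) ^ m"
    by (simp add: sum.distrib \<mu>_def power2_eq_square distrib_left)
  finally have EN2: "expect ?P (\<lambda>Xs. (N Xs)\<^sup>2) \<le> \<mu> + n\<^sup>2 * (q\<^sup>2 + p\<^sup>2) ^ m" .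
  \<comment> \<open>Without isolated vertices \<open>N\<close> vanishes and the normalised squared
    deviation equals 1.\<close>
  have "measure_pmf.prob ?P {Xs. \<forall>v<n. \<exists>u<n. joined (set Xs) v u} \<le> expect ?P (\<lambda>Xs. (N Xs - \<mu>)\<^sup>2 / \<mu>\<^sup>2)"
  proof (rule prob_le_expect)
    fix Xs assume "Xs \<in> {Xs. \<forall>v<n. \<exists>u<n. joined (set Xs) v u}"
    then have "I v Xs = 0" if "v < n" for v
      using that unfolding I_def joined_def by fastforce
    then have "N Xs = 0" by (simp add: N_def)
    then show "1 \<le> (N Xs - \<mu>)\<^sup>2 / \<mu>\<^sup>2" using mu by simp
  qed auto
  also have "\<dots> = expect ?P (\<lambda>Xs. (N Xs)\<^sup>2 / \<mu>\<^sup>2 + (1 - 2 / \<mu> * N Xs))"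
    using mu by (intro arg_cong[where f = "expect ?P"]) (auto simp: power2_eq_square field_simps)
  also have "\<dots> = expect ?P (\<lambda>Xs. (N Xs)\<^sup>2) / \<mu>\<^sup>2 - 1"
    using EN mu by simp
  also have "\<dots> \<le> (\<mu> + n\<^sup>2 * (q\<^sup>2 + p\<^sup>2) ^ m) / \<mu>\<^sup>2 - 1"
    using EN2 by (simp add: divide_right_mono)
  also have "\<dots> = 1 / \<mu> + (q\<^sup>2 + p\<^sup>2) ^ m / (q ^ m)\<^sup>2 - 1"
    using mu n by (simp add: add_divide_distrib power2_eq_square[of \<mu>])
      (simp add: \<mu>_def power2_eq_square)
  also have "(q\<^sup>2 + p\<^sup>2) ^ m / (q ^ m)\<^sup>2 = ((q\<^sup>2 + p\<^sup>2) / q\<^sup>2) ^ m"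
    by (simp only: power_divide power_mult[symmetric] mult.commute)
  also have "(q\<^sup>2 + p\<^sup>2) / q\<^sup>2 = 1 + p\<^sup>2 / q\<^sup>2" using q by (simp add: add_divide_distrib)
  finally show ?thesis by (simp add: \<mu>_def)
qed

section \<open>Expansion of random intersection graphs\<close>

text \<open>The weight is multiplicative over the features and, on the event that \<open>S\<close> fails to expand with
  closed neighbourhood \<open>U\<close>, its product is at least \<open>z ^ (card U - 1)\<close>; so Markov's inequality
  applies.\<close>

definition weight :: "real \<Rightarrow> 'a set \<Rightarrow> 'a set \<Rightarrow> 'a set \<Rightarrow> real" where
  "weight z S U X = (if X \<inter> S = {} then 1 else if X \<subseteq> U then z ^ (card X - 1) else 0)"

text \<open>A feature either misses \<open>S\<close> or contains some \<open>v\<close> in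
  \<open>S\<close>, and a union bound is taken over \<open>v\<close>. For fixed \<open>v\<close> the
  weight factorises over vertices: \<open>v\<close> contributes \<open>p\<close>, any other vertex
  of \<open>U\<close> contributes \<open>p * z + (1 - p)\<close>, which is at most
  \<open>exp (p * z)\<close>, and a vertex outside \<open>U\<close> contributes
  \<open>1 - p\<close>.\<close>

lemma expect_weight_le:
  fixes z p :: real
  assumes fin: "finite V" and p: "p \<in> {0..1}" and SU: "S \<subseteq> U" "U \<subseteq> V" and z: "z \<ge> 1"
  shows "expect (random_subset V p) (weight z S U) \<le>
    (1 - p) ^ card S + card S * p * exp (z * card U * p) * (1 - p) ^ (card V - card U)"
proof -
  let ?R = "random_subset V p"
  let ?g = "\<lambda>v X. of_bool (v \<in> X \<and> X \<subseteq> U) * z ^ (card X - 1)"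
  have finU: "finite U" "finite S" using SU fin by (meson finite_subset)+
  have g: "expect ?R (?g v) \<le> p * exp (z * card U * p) * (1 - p) ^ (card V - card U)" if v: "v \<in> S" for v
  proof -
    let ?h = "\<lambda>w b. if w = v then of_bool b else if w \<in> U then if b then z else 1 else of_bool (\<not> b) :: real"
    have vU: "v \<in> U" "v \<in> V" using v SU by auto
    have "?g v X = (\<Prod>w\<in>V. ?h w (w \<in> X))" if X: "X \<subseteq> V" for X
    proof (cases "v \<in> X \<and> X \<subseteq> U")
      case True
      then have "(\<Prod>w\<in>V. ?h w (w \<in> X)) = (\<Prod>w\<in>V. if w \<in> X - {v} then z else 1)"
        by (intro prod.cong) auto
      also have "\<dots> = z ^ card (X - {v})"
        using fin X by (subst prod.inter_restrict[symmetric])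
          (auto intro!: arg_cong[where f = "\<lambda>A. z ^ card A"])
      finally show ?thesis using True by simp
    next
      case False
      have "\<exists>w\<in>V. ?h w (w \<in> X) = 0"
      proof (cases "v \<in> X")
        case True
        then obtain w where "w \<in> X" "w \<notin> U" using False by blast
        then show ?thesis using X vU by (intro bexI[of _ w]) auto
      qed (use vU in \<open>auto intro!: bexI[of _ v]\<close>)
      then have "(\<Prod>w\<in>V. ?h w (w \<in> X)) = 0" by (rule prod_zero[OF fin])
      then show ?thesis using False by simp
    qed
    then have "expect ?R (?g v) = expect ?R (\<lambda>X. \<Prod>w\<in>V. ?h w (w \<in> X))"
      using set_random_subset[OF fin, of p] by (intro expect_cong) blast
    also have "\<dots> = (\<Prod>w\<in>V. p * ?h w True + (1 - p) * ?h w False)"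
      using z by (intro expect_random_subset_prod[OF fin p]) auto
    also have "\<dots> = (\<Prod>w\<in>V. (if w \<in> {v} then p else 1) * (if w \<in> U - {v} then p * z + (1 - p) else 1)
        * (if w \<in> V - U then 1 - p else 1))"
      using vU by (intro prod.cong) auto
    also have "\<dots> = p * (p * z + (1 - p)) ^ card (U - {v}) * (1 - p) ^ card (V - U)"
      using fin vU SU by (simp add: prod.distrib del: Diff_iff flip: prod.inter_restrict)
        (simp add: Int_absorb1 Int_absorb2 Diff_subset subset_trans[OF Diff_subset SU(2)])
    also have "card (V - U) = card V - card U" using finU SU by (simp add: card_Diff_subset)
    also have "p * (p * z + (1 - p)) ^ card (U - {v}) * (1 - p) ^ (card V - card U) \<le>
       p * exp (z * card U * p) * (1 - p) ^ (card V - card U)"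
    proof -
      have "0 \<le> p * z" using p z by auto
      moreover have "p * z + (1 - p) \<le> exp (p * z)"
        using p exp_ge_add_one_self[of "p * z"] unfolding atLeastAtMost_iff by linarith
      ultimately have "(p * z + (1 - p)) ^ card (U - {v}) \<le> exp (p * z) ^ card (U - {v})"
        using p by (intro power_mono) auto
      also have "\<dots> \<le> exp (p * z) ^ card U"
        using p z finU by (intro power_increasing card_mono) auto
      also have "\<dots> = exp (z * card U * p)" by (simp add: mult_ac flip: exp_of_nat_mult)
      finally show ?thesis using p by (intro mult_right_mono mult_left_mono) auto
    qed
    finally show ?thesis .
  qed
  have "expect ?R (weight z S U) \<le> expect ?R (\<lambda>X. of_bool ({} \<subseteq> X \<and> X \<inter> S = {}) + (\<Sum>v\<in>S. ?g v X))"
  proof (intro expect_mono)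
    fix X
    have nn: "0 \<le> ?g v X" for v using z by auto
    show "weight z S U X \<le> of_bool ({} \<subseteq> X \<and> X \<inter> S = {}) + (\<Sum>v\<in>S. ?g v X)"
    proof (cases "X \<inter> S = {} \<or> \<not> X \<subseteq> U")
      case True
      then show ?thesis using nn by (auto simp: weight_def intro!: sum_nonneg)
    next
      case False
      then obtain v where v: "v \<in> X" "v \<in> S" by blast
      then have "?g v X \<le> (\<Sum>v\<in>S. ?g v X)" using finU nn by (intro member_le_sum) auto
      then show ?thesis using False v by (simp add: weight_def)
    qed
  qed (use fin in auto)
  also have "\<dots> = (1 - p) ^ card S + (\<Sum>v\<in>S. expect ?R (?g v))"
    using prob_random_subset_cylinder[OF fin p, of "{}" S] SU fin
    by (simp add: prob_eq_expect Bochner_Integration.integral_sum)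
  also have "(\<Sum>v\<in>S. expect ?R (?g v)) \<le> (\<Sum>v\<in>S. p * exp (z * card U * p) * (1 - p) ^ (card V - card U))"
    by (intro sum_mono g)
  finally show ?thesis by (simp add: mult.assoc)
qed

text \<open>Connectivity counts equal vertex sets once, while independence gives a product over all
  features; since every factor is at least 1 on the event considered, repetitions do no
  harm.\<close>

lemma prod_set_le_prod_list:
  fixes f :: "'a \<Rightarrow> real"
  assumes "\<And>x. x \<in> set xs \<Longrightarrow> 1 \<le> f x"
  shows "(\<Prod>x\<in>set xs. f x) \<le> (\<Prod>x\<leftarrow>xs. f x)"
  using assms
proof (induction xs)
  case (Cons a xs)
  have nn: "1 \<le> (\<Prod>x\<in>set xs. f x)" using Cons.prems by (intro prod_ge_1) auto
  have IH: "(\<Prod>x\<in>set xs. f x) \<le> (\<Prod>x\<leftarrow>xs. f x)" using Cons by simp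
  have fa: "1 \<le> f a" using Cons.prems by simp
  show ?case
  proof (cases "a \<in> set xs")
    case True
    have "1 * (\<Prod>x\<leftarrow>xs. f x) \<le> f a * (\<Prod>x\<leftarrow>xs. f x)" using fa nn IH by (intro mult_right_mono) auto
    then show ?thesis using IH True by (simp add: insert_absorb)
  next
    case False
    then show ?thesis using IH fa by (simp add: mult_left_mono)
  qed
qed simp

lemma prob_closed_connected_le:
  fixes z p :: real
  assumes fin: "finite V" and p: "p \<in> {0..1}" and SU: "S \<subseteq> U" "U \<subseteq> V" and z: "z \<ge> 1"
  shows "measure_pmf.prob (replicate_pmf m (random_subset V p))
      {Xs. (\<forall>X\<in>set Xs. X \<inter> S \<noteq> {} \<longrightarrow> X \<subseteq> U) \<and>
        card U \<le> 1 + (\<Sum>X | X \<in> set Xs \<and> X \<inter> S \<noteq> {}. card X - 1)}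
    \<le> ((1 - p) ^ card S + card S * p * exp (z * card U * p) * (1 - p) ^ (card V - card U)) ^ m
      / z ^ (card U - 1)"
proof -
  let ?R = "random_subset V p"
  have w: "0 \<le> weight z S U X" for X using z by (auto simp: weight_def)
  have "measure_pmf.prob (replicate_pmf m ?R)
      {Xs. (\<forall>X\<in>set Xs. X \<inter> S \<noteq> {} \<longrightarrow> X \<subseteq> U) \<and>
        card U \<le> 1 + (\<Sum>X | X \<in> set Xs \<and> X \<inter> S \<noteq> {}. card X - 1)}
    \<le> expect (replicate_pmf m ?R) (\<lambda>Xs. (\<Prod>X\<leftarrow>Xs. weight z S U X) / z ^ (card U - 1))"
  proof (rule prob_le_expect)
    fix Xs assume "Xs \<in> {Xs. (\<forall>X\<in>set Xs. X \<inter> S \<noteq> {} \<longrightarrow> X \<subseteq> U) \<and>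
        card U \<le> 1 + (\<Sum>X | X \<in> set Xs \<and> X \<inter> S \<noteq> {}. card X - 1)}"
    then have cl: "\<And>X. X \<in> set Xs \<Longrightarrow> X \<inter> S \<noteq> {} \<Longrightarrow> X \<subseteq> U"
      and cU: "card U - 1 \<le> (\<Sum>X | X \<in> set Xs \<and> X \<inter> S \<noteq> {}. card X - 1)" by auto
    have "z ^ (card U - 1) \<le> z ^ (\<Sum>X | X \<in> set Xs \<and> X \<inter> S \<noteq> {}. card X - 1)"
      using cU z by (intro power_increasing) auto
    also have "\<dots> = (\<Prod>X | X \<in> set Xs \<and> X \<inter> S \<noteq> {}. z ^ (card X - 1))" by (simp add: power_sum)
    also have "\<dots> = (\<Prod>X\<in>set Xs. weight z S U X)"
      using cl by (intro prod.mono_neutral_cong_left) (auto simp: weight_def)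
    also have "\<dots> \<le> (\<Prod>X\<leftarrow>Xs. weight z S U X)"
      using cl z by (intro prod_set_le_prod_list) (auto simp: weight_def)
    finally show "1 \<le> (\<Prod>X\<leftarrow>Xs. weight z S U X) / z ^ (card U - 1)"
      using z by simp
  qed (use fin z w in \<open>auto intro!: divide_nonneg_nonneg prod_list_nonneg\<close>)
  also have "\<dots> = expect ?R (weight z S U) ^ m / z ^ (card U - 1)"
    using expect_replicate_prod[of ?R m "weight z S U"] fin by simp
  also have "\<dots> \<le> ((1 - p) ^ card S + card S * p * exp (z * card U * p) * (1 - p) ^ (card V - card U)) ^ m
      / z ^ (card U - 1)"
    using w z by (intro divide_right_mono power_mono expect_weight_le[OF fin p SU z])
      (auto intro!: Bochner_Integration.integral_nonneg)
  finally show ?thesis .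
qed

text \<open>Union bound over the witness pairs of \<open>not_expander_witness\<close>. As
  \<open>T\<close> depends on the size of \<open>U\<close> only, the choice of \<open>S\<close>
  inside \<open>U\<close> costs at most 2^u; the Markov parameter \<open>z\<close> may be tuned to
  each size.\<close>

lemma prob_not_expander_le:
  fixes z T :: "nat \<Rightarrow> real"
  assumes p: "p \<in> {0..1}" and z: "\<And>u. z u \<ge> 1" and T0: "\<And>u. T u \<ge> 0"
    and T: "\<And>s u. 1 \<le> s \<Longrightarrow> s \<le> u \<Longrightarrow> u < 2 * s \<Longrightarrow> 8 * u \<le> n \<Longrightarrow>
      ((1 - p) ^ s + s * p * exp (z u * u * p) * (1 - p) ^ (n - u)) ^ m / z u ^ (u - 1) \<le> T u"
  shows "measure_pmf.prob (replicate_pmf m (random_subset {..<n} p)) {Xs. \<not> expander {..<n} (set Xs)}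
    \<le> (\<Sum>u = 1..n div 8. (n choose u) * 2 ^ u * T u)"
proof -
  let ?V = "{..<n}"
  let ?P = "replicate_pmf m (random_subset ?V p)"
  let ?E = "\<lambda>(U, S). {Xs. (\<forall>X\<in>set Xs. X \<inter> S \<noteq> {} \<longrightarrow> X \<subseteq> U) \<and>
        card U \<le> 1 + (\<Sum>X | X \<in> set Xs \<and> X \<inter> S \<noteq> {}. card X - 1)}"
  define \<U> where "\<U> = {U. U \<subseteq> ?V \<and> card U \<in> {1..n div 8}}"
  define \<I> where "\<I> = {(U, S). U \<in> \<U> \<and> S \<subseteq> U \<and> S \<noteq> {} \<and> card U < 2 * card S}"
  have fU: "finite \<U>" unfolding \<U>_def by (rule finite_subset[of _ "Pow ?V"]) auto
  have finU: "finite U" if "U \<in> \<U>" for U using that by (auto simp: \<U>_def intro: finite_subset)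
  have sub: "\<I> \<subseteq> Sigma \<U> Pow" by (auto simp: \<I>_def)
  have fS: "finite (Sigma \<U> Pow)" using fU finU by (intro finite_SigmaI) auto
  then have fI: "finite \<I>" using sub finite_subset by blast
  have "measure_pmf.prob ?P {Xs. \<not> expander ?V (set Xs)} \<le> measure_pmf.prob ?P (\<Union>i\<in>\<I>. ?E i)"
  proof -
    have "Xs \<in> (\<Union>i\<in>\<I>. ?E i)" if Xs: "Xs \<in> set_pmf ?P" and ne: "\<not> expander ?V (set Xs)" for Xs
    proof -
      have XV: "\<And>X. X \<in> set Xs \<Longrightarrow> X \<subseteq> ?V"
        using Xs set_random_subset[of ?V p] by (auto simp: set_replicate_pmf)
      show ?thesis
      proof (rule not_expander_witness[OF finite_lessThan List.finite_set XV ne])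
        fix S U
        assume SU: "S \<subseteq> U" "U \<subseteq> ?V" "S \<noteq> {}" "card U < 2 * card S" "16 * card S \<le> card ?V"
          "\<And>X. X \<in> set Xs \<Longrightarrow> X \<inter> S \<noteq> {} \<Longrightarrow> X \<subseteq> U"
          "card U \<le> 1 + (\<Sum>X | X \<in> set Xs \<and> X \<inter> S \<noteq> {}. card X - 1)"
        have "U \<noteq> {}" using SU(1,3) by blast
        then have "1 \<le> card U" using finite_subset[OF SU(2)] by (simp add: Suc_leI card_gt_0_iff)
        moreover have "card U \<le> n div 8" using SU(4,5) by simp
        ultimately have "(U, S) \<in> \<I>" using SU(1-4) by (auto simp: \<I>_def \<U>_def)
        moreover have "Xs \<in> ?E (U, S)" using SU(6,7) by simp
        ultimately show ?thesis by blast
      qed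
    qed
    then show ?thesis
      by (intro measure_pmf.finite_measure_mono_AE) (auto simp: AE_measure_pmf_iff)
  qed
  also have "\<dots> \<le> (\<Sum>i\<in>\<I>. measure_pmf.prob ?P (?E i))"
    by (intro measure_pmf.finite_measure_subadditive_finite fI) auto
  also have "\<dots> \<le> (\<Sum>i\<in>\<I>. T (card (fst i)))"
  proof (intro sum_mono)
    fix i assume "i \<in> \<I>"
    then obtain U S where i: "i = (U, S)" "U \<subseteq> ?V" "card U \<in> {1..n div 8}" "S \<subseteq> U" "S \<noteq> {}" "card U < 2 * card S"
      by (auto simp: \<I>_def \<U>_def)
    have fin: "finite U" "finite S" using i by (meson finite_lessThan finite_subset)+
    have "card S \<ge> 1" using i fin by (simp add: Suc_leI card_gt_0_iff)
    moreover have "card S \<le> card U" using i fin by (intro card_mono)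
    ultimately show "measure_pmf.prob ?P (?E i) \<le> T (card (fst i))"
      using prob_closed_connected_le[OF _ p i(4,2) z[of "card U"], of m] T[of "card S" "card U"] i
      by fastforce
  qed
  also have "\<dots> \<le> (\<Sum>i\<in>Sigma \<U> Pow. T (card (fst i)))"
    by (intro sum_mono2 fS sub T0)
  also have "\<dots> = (\<Sum>U\<in>\<U>. \<Sum>S\<in>Pow U. T (card U))"
    using fU finU by (subst sum.Sigma) (auto simp: case_prod_beta)
  also have "\<dots> = (\<Sum>U\<in>\<U>. 2 ^ card U * T (card U))"
    using finU by (simp add: card_Pow)
  also have "\<dots> = (\<Sum>u = 1..n div 8. \<Sum>U\<in>{U\<in>\<U>. card U = u}. 2 ^ card U * T (card U))"
    using fU by (intro sum.group[symmetric]) (auto simp: \<U>_def)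
  also have "\<dots> = (\<Sum>u = 1..n div 8. (n choose u) * 2 ^ u * T u)"
  proof (intro sum.cong refl)
    fix u assume u: "u \<in> {1..n div 8}"
    have "{U\<in>\<U>. card U = u} = {U. U \<subseteq> ?V \<and> card U = u}" using u by (auto simp: \<U>_def)
    then have "card {U\<in>\<U>. card U = u} = n choose u" using n_subsets[of ?V u] by simp
    then show "(\<Sum>U\<in>{U\<in>\<U>. card U = u}. 2 ^ card U * T (card U)) = (n choose u) * 2 ^ u * T u" by simp
  qed
  finally show ?thesis .
qed

section \<open>Elementary estimates and the moment of a single closed set\<close>

lemma binomial_le_exp_power:
  assumes "u > 0"
  shows "real (n choose u) \<le> (exp 1 * n / u) ^ u"
proof -
  have "(\<lambda>k. inverse (fact k) * real u ^ k) sums exp (real u)"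
    using exp_converges[of "real u"] by simp
  then have "summable (\<lambda>k. inverse (fact k) * real u ^ k)"
    "(\<Sum>k. inverse (fact k) * real u ^ k) = exp (real u)"
    by (simp_all add: sums_iff)
  \<comment> \<open>A single term of the exponential series is at most its sum, which bounds
    \<open>u ^ u / fact u\<close>.\<close>
  then have "(\<Sum>k\<in>{u}. inverse (fact k) * real u ^ k) \<le> exp (real u)"
    using sum_le_suminf[of "\<lambda>k. inverse (fact k) * real u ^ k" "{u}"] by simp
  then have e: "real u ^ u \<le> exp 1 ^ u * fact u"
    by (simp add: field_simps flip: exp_of_nat_mult)
  have "(n choose u) * fact u \<le> n ^ u" by (rule binomial_fact_pow)
  then have "real ((n choose u) * fact u) \<le> real (n ^ u)" by (rule of_nat_mono)
  then have "real (n choose u) \<le> real n ^ u / fact u" by (simp add: field_simps)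
  also have "\<dots> \<le> real n ^ u * exp 1 ^ u / real u ^ u"
    using mult_left_mono[OF e, of "real n ^ u"] assms by (simp add: field_simps)
  also have "\<dots> = (exp 1 * n / u) ^ u" by (simp add: power_divide power_mult_distrib mult.commute)
  finally show ?thesis .
qed

lemma exp_minus_le_quadratic:
  fixes y :: real
  assumes "y \<ge> 0"
  shows "exp (- y) \<le> 1 - y + y\<^sup>2"
proof -
  have "1 + y \<le> exp y" by (rule exp_ge_add_one_self)
  then have "exp (- y) \<le> 1 / (1 + y)" using assms by (simp add: exp_minus field_simps)
  also have "\<dots> \<le> 1 - y + y\<^sup>2"
    using assms by (simp add: divide_simps power2_eq_square) (simp add: algebra_simps)
  finally show ?thesis .
qed

lemma power_one_minus_le_exp:
  fixes p :: real
  assumes "p \<le> 1"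
  shows "(1 - p) ^ k \<le> exp (- (k * p))"
proof -
  have "(1 - p) ^ k \<le> exp (- p) ^ k"
    using assms exp_ge_add_one_self[of "- p"] by (intro power_mono) auto
  then show ?thesis by (simp flip: exp_of_nat_mult)
qed

text \<open>For \<open>\<alpha> \<le> 1\<close> features are large, and \<open>(1 - p) ^ (n - u)\<close> beats the other exponential factors.\<close>

lemma moment_le_large_features:
  fixes p w :: real
  assumes p: "p \<in> {0..1}" and su: "s \<le> u" "8 * u \<le> n" and w: "8 * w \<le> n"
    and mp: "m * p \<le> exp (5 / 8 * (n * p))"
  shows "((1 - p) ^ s + s * p * exp (w * p) * (1 - p) ^ (n - u)) ^ m \<le> exp (- (s * (m * p - 1)))"
proof -
  have un: "u \<le> n" using su by simp
  have "(1 - p) ^ (n - u) \<le> exp (- ((n - u) * p))"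
    using power_one_minus_le_exp[of p "n - u"] p un by (simp add: of_nat_diff)
  then have "s * p * exp (w * p) * (1 - p) ^ (n - u) \<le> s * p * exp (w * p) * exp (- ((n - u) * p))"
    using p by (intro mult_left_mono) auto
  also have "\<dots> = exp (- (s * p)) * (s * p * exp ((s + w + u - n) * p))"
    using un by (simp add: algebra_simps of_nat_diff flip: exp_add)
  also have "\<dots> \<le> exp (- (s * p)) * (s * p * exp (- (5 / 8 * (n * p))))"
  proof -
    \<comment> \<open>Each of \<open>s\<close>, \<open>w\<close> and \<open>u\<close> is at most n /
      8, which leaves the 5 / 8.\<close>
    have "(s + w + u - n) \<le> - (5 / 8 * n)" using su w by linarith
    then have "(s + w + u - n) * p \<le> - (5 / 8 * n) * p" using p by (intro mult_right_mono) auto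
    then show ?thesis using p by (intro mult_left_mono) auto
  qed
  finally have "(1 - p) ^ s + s * p * exp (w * p) * (1 - p) ^ (n - u) \<le>
      exp (- (s * p)) * (1 + s * p * exp (- (5 / 8 * (n * p))))"
    using power_one_minus_le_exp[of p s] p by (simp add: algebra_simps)
  also have "\<dots> \<le> exp (- (s * p)) * exp (s * p * exp (- (5 / 8 * (n * p))))"
    by (intro mult_left_mono exp_ge_add_one_self) auto
  also have "\<dots> = exp (- (s * p) + s * p * exp (- (5 / 8 * (n * p))))" by (simp only: exp_add)
  finally have "((1 - p) ^ s + s * p * exp (w * p) * (1 - p) ^ (n - u)) ^ m \<le>
      exp (- (s * p) + s * p * exp (- (5 / 8 * (n * p)))) ^ m"
    using p by (intro power_mono) auto
  also have "\<dots> = exp (- (s * (m * p)) + s * (m * p * exp (- (5 / 8 * (n * p)))))"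
    by (simp add: algebra_simps flip: exp_of_nat_mult)
  also have "\<dots> \<le> exp (- (s * (m * p)) + s * 1)"
  proof -
    \<comment> \<open>Over all m features, those that touch \<open>S\<close> without leaving
      \<open>U\<close> thus contribute at most a factor exp s: the -1 in the exponent of the
      claim.\<close>
    have "m * p * exp (- (5 / 8 * (n * p))) \<le> 1"
      using mp by (simp add: exp_minus field_simps)
    then have "s * (m * p * exp (- (5 / 8 * (n * p)))) \<le> real s * 1" by (intro mult_left_mono) auto
    then show ?thesis by simp
  qed
  finally show ?thesis by (simp add: algebra_simps)
qed

text \<open>For \<open>\<alpha> > 1\<close> most features have at most one vertex, \<open>n p\<close> is small, and the first-order terms
  cancel, so a second-order expansion is needed.\<close>

lemma moment_le_small_features:
  fixes p w :: real
  assumes p: "p \<in> {0..1}" and su: "s \<le> u" "u + w \<le> n" and w: "w \<ge> 0"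
  shows "((1 - p) ^ s + s * p * exp (w * p) * (1 - p) ^ (n - u)) ^ m
    \<le> exp (- (s * (real m * n * p\<^sup>2 * (1 - (2 * real u + w) / n - n * p))))"
proof (cases "n = 0")
  case True
  then have "u = 0" "s = 0" using su w by auto
  then show ?thesis by simp
next
  case False
  have un: "u \<le> n" using su w by simp
  let ?y = "p * (n - u - w)"
  have y: "0 \<le> ?y" "?y \<le> p * n" using p su w by (auto intro!: mult_left_mono)
  have "(1 - p) ^ (n - u) \<le> exp (- ((n - u) * p))"
    using power_one_minus_le_exp[of p "n - u"] p un by (simp add: of_nat_diff)
  then have "s * p * exp (w * p) * (1 - p) ^ (n - u) \<le> s * p * exp (w * p) * exp (- ((n - u) * p))"
    using p by (intro mult_left_mono) auto
  also have "\<dots> = s * p * exp (- ?y)"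
    using un by (simp add: algebra_simps of_nat_diff flip: exp_add)
  also have "\<dots> \<le> s * p * (1 - ?y + ?y\<^sup>2)"
    using p y by (intro mult_left_mono exp_minus_le_quadratic) auto
  also have "\<dots> \<le> s * p * (1 - ?y + (p * n)\<^sup>2)"
    using p power_mono[OF y(2,1), of 2] by (intro mult_left_mono) auto
  finally have 1: "s * p * exp (w * p) * (1 - p) ^ (n - u) \<le> s * p * (1 - ?y + (p * n)\<^sup>2)" .
  have "(1 - p) ^ s \<le> exp (- (s * p))" using power_one_minus_le_exp[of p s] p by simp
  also have "\<dots> \<le> 1 - s * p + (s * p)\<^sup>2" using p by (intro exp_minus_le_quadratic) auto
  \<comment> \<open>One factor \<open>s\<close> is traded for \<open>u\<close>, so that every error
    term is a multiple of \<open>s * p\<close> and the exponent stays proportional to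
    \<open>s\<close>.\<close>
  also have "(s * p)\<^sup>2 \<le> s * p * (u * p)"
    using p su unfolding power2_eq_square by (intro mult_left_mono mult_right_mono) auto
  finally have "(1 - p) ^ s + s * p * exp (w * p) * (1 - p) ^ (n - u) \<le>
      1 - s * p * (?y - (p * n)\<^sup>2 - u * p)"
    using 1 by (simp add: algebra_simps)
  also have "?y - (p * n)\<^sup>2 - u * p = n * p * (1 - (2 * real u + w) / n - n * p)"
    using False un by (simp add: field_simps power2_eq_square of_nat_diff)
  also have "1 - s * p * (n * p * (1 - (2 * real u + w) / n - n * p)) \<le>
      exp (- (s * p * (n * p * (1 - (2 * real u + w) / n - n * p))))"
    using exp_ge_add_one_self[of "- (s * p * (n * p * (1 - (2 * real u + w) / n - n * p)))"] by simp
  finally have "((1 - p) ^ s + s * p * exp (w * p) * (1 - p) ^ (n - u)) ^ m \<le>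
      exp (- (s * p * (n * p * (1 - (2 * real u + w) / n - n * p)))) ^ m"
    using p by (intro power_mono) auto
  also have "\<dots> = exp (- (s * (real m * n * p\<^sup>2 * (1 - (2 * real u + w) / n - n * p))))"
    by (simp add: power2_eq_square mult_ac flip: exp_of_nat_mult)
  finally show ?thesis .
qed

text \<open>The choice \<open>z = n / (u * L)\<close> makes \<open>z ^ (u - 1)\<close> cancel the binomial coefficient up to the factor
  \<open>n (2 e L) ^ (u - 1)\<close>, which \<open>(K / n) ^ s\<close> beats because \<open>2 s > u\<close>.\<close>

lemma prob_not_expander_bound:
  fixes p \<omega> :: real and n m :: nat
  defines "L \<equiv> ln (real n)"
  assumes p: "p \<in> {0..1}" and w: "\<omega> \<ge> 0" and L: "L \<ge> 8"
    and small: "4 * exp 1 * L * sqrt (exp 7 / n) \<le> 1" "4 * exp 1 * L * exp (- (L / 4)) \<le> 1"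
    and regime: "m * p \<ge> L + \<omega> \<and> m * p \<le> exp (5 / 8 * (n * p)) \<or>
      real m * n * p\<^sup>2 \<ge> L + \<omega> \<and> real m * n * p\<^sup>2 \<le> 2 * L \<and> 8 * L * (n * p) \<le> 1"
  shows "measure_pmf.prob (replicate_pmf m (random_subset {..<n} p)) {Xs. \<not> expander {..<n} (set Xs)}
    \<le> 4 * exp (8 - \<omega>) + 4 * exp 1 * L * exp (- (L / 4))"
proof -
  define z where "z u = max 1 (n / (u * L))" for u :: nat
  \<comment> \<open>The moment bound is (K / n)^s. The loss 7 covers 6 = 2 L * (3 / L) from the size
    of \<open>U\<close> and at most 1 from \<open>n * p\<close>; this is the loss in the
    small-feature regime, and the other regime loses only 1.\<close>
  define K where "K = exp (7 - \<omega>)"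
  define \<kappa> where "\<kappa> = sqrt (K / n)"
  \<comment> \<open>While \<open>u * L \<le> n\<close>, connectivity pays the factor
    \<open>(u * L / n) ^ (u - 1)\<close>. For larger \<open>u\<close> one has
    \<open>z u = 1\<close>: the binomial coefficient is then at most (e L)^u, and closedness alone
    suffices.\<close>
  define T where "T u = (if u * L \<le> n then (u * L / n) ^ (u - 1) * \<kappa> ^ (u + 1) else exp (- (L / 4)) ^ u)"
    for u :: nat
  have n0: "n > 0" using L by (cases n) (auto simp: L_def)
  have expL: "exp L = n" using n0 by (simp add: L_def)
  have n8: "real n \<ge> 8" using exp_ge_add_one_self[of L] expL L by simp
  have kap: "0 < \<kappa>" "\<kappa>\<^sup>2 = K / n" using n0 by (auto simp: \<kappa>_def K_def)
  have yk: "2 * exp 1 * L * \<kappa> \<le> 1 / 2"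
  proof -
    have "\<kappa> \<le> sqrt (exp 7 / n)" unfolding \<kappa>_def K_def using w n0
      by (intro real_sqrt_le_mono divide_right_mono) auto
    then have "4 * exp 1 * L * \<kappa> \<le> 4 * exp 1 * L * sqrt (exp 7 / n)" using L by (intro mult_left_mono) auto
    then have "4 * exp 1 * L * \<kappa> \<le> 1" using small(1) by linarith
    then show ?thesis by linarith
  qed
  have kap1: "\<kappa> \<le> 1"
  proof -
    have "2 * exp 1 * L \<ge> (1 :: real)"
      using L mult_mono[of 1 "exp 1 :: real" 1 L] by simp
    then have "1 * \<kappa> \<le> 2 * exp 1 * L * \<kappa>" using kap by (intro mult_right_mono) auto
    then show ?thesis using yk by simp
  qed
  have phi: "(u * L \<le> n \<longrightarrow>
      ((1 - p) ^ s + s * p * exp (z u * u * p) * (1 - p) ^ (n - u)) ^ m \<le> exp (- (s * (L + \<omega> - 7)))) \<and>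
     (\<not> u * L \<le> n \<longrightarrow>
      ((1 - p) ^ s + s * p * exp (z u * u * p) * (1 - p) ^ (n - u)) ^ m \<le> exp (- (s * (L / 2))))"
    if su: "1 \<le> s" "s \<le> u" "8 * u \<le> n" for s u :: nat
  proof -
    have u0: "u > 0" using su by simp
    have zu: "z u * u = max (real u) (n / L)"
      using u0 L by (simp add: z_def max_mult_distrib_right)
    have nL: "8 * (n / L) \<le> n" using L n0 by (simp add: field_simps)
    then have zu8: "8 * (z u * u) \<le> n" using su zu by simp
    from regime show ?thesis
    proof
      assume A: "m * p \<ge> L + \<omega> \<and> m * p \<le> exp (5 / 8 * (n * p))"
      have "((1 - p) ^ s + s * p * exp (z u * u * p) * (1 - p) ^ (n - u)) ^ m \<le> exp (- (s * (m * p - 1)))"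
        by (rule moment_le_large_features) (use p su zu8 A in auto)
      also have "\<dots> \<le> exp (- (s * (L + \<omega> - 1)))"
        using A by (auto intro!: mult_left_mono)
      finally have B: "((1 - p) ^ s + s * p * exp (z u * u * p) * (1 - p) ^ (n - u)) ^ m \<le> exp (- (s * (L + \<omega> - 1)))" .
      have "L / 2 \<le> L + \<omega> - 1" using L w by linarith
      then have "real s * (L / 2) \<le> s * (L + \<omega> - 1)" by (rule mult_left_mono) simp
      then have "exp (- (s * (L + \<omega> - 1))) \<le> exp (- (s * (L / 2)))"
        by (simp only: exp_le_cancel_iff neg_le_iff_le)
      moreover have "exp (- (s * (L + \<omega> - 1))) \<le> exp (- (s * (L + \<omega> - 7)))"
        by (auto intro!: mult_left_mono)
      ultimately show ?thesis using B by (meson order_trans)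
    next
      assume A: "real m * n * p\<^sup>2 \<ge> L + \<omega> \<and> real m * n * p\<^sup>2 \<le> 2 * L \<and> 8 * L * (n * p) \<le> 1"
      let ?\<Lambda> = "real m * n * p\<^sup>2" and ?r = "(2 * real u + z u * u) / n + n * p"
      have Lam: "0 \<le> ?\<Lambda>" by simp
      have np: "0 \<le> n * p" using p by simp
      have np8: "n * p \<le> 1 / 8"
      proof -
        have "1 * (n * p) \<le> L * (n * p)" using np L by (intro mult_right_mono) auto
        then show ?thesis using A by simp
      qed
      have M: "((1 - p) ^ s + s * p * exp (z u * u * p) * (1 - p) ^ (n - u)) ^ m
         \<le> exp (- (s * (?\<Lambda> * (1 - (2 * real u + z u * u) / n - n * p))))"
        by (rule moment_le_small_features) (use p su zu8 zu in auto)
      have C: "?\<Lambda> * (1 - (2 * real u + z u * u) / n - n * p) = ?\<Lambda> - ?\<Lambda> * ?r"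
        by (simp add: algebra_simps)
      have r0: "0 \<le> ?r" using np zu by simp
      show ?thesis
      proof (cases "u * L \<le> n")
        case True
        then have un: "real u \<le> n / L" using L by (simp add: field_simps)
        then have "(2 * real u + z u * u) / n \<le> (3 * (n / L)) / n"
          unfolding zu by (intro divide_right_mono) auto
        also have "\<dots> = 3 / L" using n0 by simp
        finally have "?r \<le> 3 / L + n * p" by simp
        then have "?\<Lambda> * ?r \<le> 2 * L * (3 / L + n * p)"
          by (rule mult_mono[rotated]) (use A r0 L in auto)
        also have "\<dots> = 6 + 2 * L * (n * p)" using L by (simp add: field_simps)
        also have "\<dots> \<le> 7" using A by simp
        finally have "L + \<omega> - 7 \<le> ?\<Lambda> - ?\<Lambda> * ?r" using A by linarith
        then have "real s * (L + \<omega> - 7) \<le> s * (?\<Lambda> - ?\<Lambda> * ?r)" by (rule mult_left_mono) simp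
        then have "exp (- (s * (?\<Lambda> - ?\<Lambda> * ?r))) \<le> exp (- (s * (L + \<omega> - 7)))"
          by (simp only: exp_le_cancel_iff neg_le_iff_le)
        then show ?thesis using M True unfolding C by (meson order_trans)
      next
        case False
        then have un: "n / L \<le> u" using L by (simp add: field_simps)
        then have "(2 * real u + z u * u) / n = 3 * u / n" unfolding zu by (simp add: max_absorb1)
        also have "\<dots> \<le> 3 / 8" using su n0 by (simp add: field_simps)
        finally have "?r \<le> 1 / 2" using np8 by linarith
        then have "?\<Lambda> * ?r \<le> ?\<Lambda> * (1 / 2)" using Lam by (intro mult_left_mono) auto
        then have "L / 2 \<le> ?\<Lambda> - ?\<Lambda> * ?r" using A w by linarith
        then have "real s * (L / 2) \<le> s * (?\<Lambda> - ?\<Lambda> * ?r)" by (rule mult_left_mono) simp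
        then have "exp (- (s * (?\<Lambda> - ?\<Lambda> * ?r))) \<le> exp (- (s * (L / 2)))"
          by (simp only: exp_le_cancel_iff neg_le_iff_le)
        then show ?thesis using M False unfolding C by (meson order_trans)
      qed
    qed
  qed
  have "measure_pmf.prob (replicate_pmf m (random_subset {..<n} p)) {Xs. \<not> expander {..<n} (set Xs)}
    \<le> (\<Sum>u = 1..n div 8. (n choose u) * 2 ^ u * T u)"
  proof (rule prob_not_expander_le[OF p, of z T])
    show "1 \<le> z u" for u by (simp add: z_def)
    show "0 \<le> T u" for u using kap L by (auto simp: T_def)
    fix s u :: nat assume su: "1 \<le> s" "s \<le> u" "u < 2 * s" "8 * u \<le> n"
    let ?\<phi> = "((1 - p) ^ s + s * p * exp (z u * u * p) * (1 - p) ^ (n - u)) ^ m"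
    have u0: "u > 0" using su by simp
    show "?\<phi> / z u ^ (u - 1) \<le> T u"
    proof (cases "u * L \<le> n")
      case True
      then have "z u = n / (u * L)" using u0 L n0 by (simp add: z_def max_def field_simps)
      then have zz: "1 / z u ^ (u - 1) = (u * L / n) ^ (u - 1)" by (simp add: power_divide)
      have "?\<phi> \<le> exp (- (s * (L + \<omega> - 7)))" using phi[OF su(1,2,4)] True by blast
      also have "\<dots> = exp (7 - \<omega> - L) ^ s" by (simp add: algebra_simps flip: exp_of_nat_mult)
      also have "exp (7 - \<omega> - L) = \<kappa>\<^sup>2" unfolding kap K_def by (simp add: exp_diff expL)
      also have "(\<kappa>\<^sup>2) ^ s = \<kappa> ^ (2 * s)" by (simp add: power_mult)
      \<comment> \<open>The strict inequality \<open>u < 2 * s\<close> gives the exponent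
        \<open>u + 1\<close>; the extra power will be needed.\<close>
      also have "\<dots> \<le> \<kappa> ^ (u + 1)" using kap kap1 su by (intro power_decreasing) auto
      finally have "?\<phi> \<le> \<kappa> ^ (u + 1)" .
      then have "?\<phi> * (1 / z u ^ (u - 1)) \<le> \<kappa> ^ (u + 1) * (1 / z u ^ (u - 1))"
        by (intro mult_right_mono) (auto simp: z_def)
      also have "\<kappa> ^ (u + 1) * (1 / z u ^ (u - 1)) = T u"
        using True by (simp only: zz) (simp add: T_def)
      finally show ?thesis by simp
    next
      case False
      have z1: "1 \<le> z u ^ (u - 1)" by (simp add: z_def)
      have "?\<phi> / z u ^ (u - 1) \<le> ?\<phi> / 1"
        using z1 p by (intro divide_left_mono) auto
      also have "\<dots> \<le> exp (- (s * (L / 2)))" using phi[OF su(1,2,4)] False by simp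
      also have "\<dots> = exp (- (L / 4)) ^ (2 * s)" by (simp flip: exp_of_nat_mult)
      also have "\<dots> \<le> exp (- (L / 4)) ^ u" using L su by (intro power_decreasing) auto
      finally show ?thesis using False by (simp add: T_def)
    qed
  qed
  also have "\<dots> \<le> (\<Sum>u = 1..n div 8. (2 * exp 1 * K + 2 * exp 1 * L * exp (- (L / 4))) * (1 / 2) ^ (u - 1))"
  proof (intro sum_mono)
    fix u assume u: "u \<in> {1..n div 8}"
    then have u0: "u > 0" by simp
    have Su: "u = Suc (u - 1)" using u0 by simp
    let ?x = "2 * exp 1 * L * exp (- (L / 4))"
    have x: "0 \<le> ?x" "?x \<le> 1 / 2" using L small by auto
    have "(n choose u) * 2 ^ u * T u \<le> (exp 1 * n / u) ^ u * 2 ^ u * T u"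
      using binomial_le_exp_power[OF u0, of n] kap L by (intro mult_right_mono) (auto simp: T_def)
    also have "\<dots> = (2 * exp 1 * n / u) ^ u * T u" by (simp flip: power_mult_distrib) (simp add: mult_ac)
    also have "\<dots> \<le> (2 * exp 1 * K + ?x) * (1 / 2) ^ (u - 1)"
    proof (cases "u * L \<le> n")
      case True
      \<comment> \<open>Of the \<open>u + 1\<close> factors \<kappa>, \<open>u - 1\<close> make the
        geometric ratio small, and the remaining \<kappa> squared, equal to K / n, cancels the one
        factor n that connectivity leaves over.\<close>
      have "(2 * exp 1 * n / u) ^ u * T u =
          (2 * exp 1 * n / u) ^ Suc (u - 1) * (u * L / n) ^ (u - 1) * \<kappa> ^ (u - 1) * \<kappa>\<^sup>2"
        using True Su by (simp add: T_def power2_eq_square mult_ac) (metis power_Suc mult.commute)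
      also have "\<dots> = (2 * exp 1 * n / u) * \<kappa>\<^sup>2 * ((2 * exp 1 * n / u) * (u * L / n) * \<kappa>) ^ (u - 1)"
      proof -
        have "a ^ Suc k * b ^ k * \<kappa> ^ k * \<kappa>\<^sup>2 = a * \<kappa>\<^sup>2 * (a * b * \<kappa>) ^ k" for a b :: real and k
          by (simp add: power_mult_distrib)
        then show ?thesis .
      qed
      also have "(2 * exp 1 * n / u) * (u * L / n) * \<kappa> = 2 * exp 1 * L * \<kappa>"
        using n0 u0 by simp
      also have "(2 * exp 1 * n / u) * \<kappa>\<^sup>2 = 2 * exp 1 * K / u" using kap n0 by simp
      also have "2 * exp 1 * K / u * (2 * exp 1 * L * \<kappa>) ^ (u - 1) \<le> (2 * exp 1 * K) * (1 / 2) ^ (u - 1)"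
        using yk kap L u0 by (intro mult_mono power_mono) (auto simp: K_def field_simps)
      also have "\<dots> \<le> (2 * exp 1 * K + ?x) * (1 / 2) ^ (u - 1)"
        using x by (intro mult_right_mono) auto
      finally show ?thesis .
    next
      case False
      then have "n / u \<le> L" using u0 by (simp add: field_simps)
      then have "2 * exp 1 * (n / u) * exp (- (L / 4)) \<le> ?x"
        by (intro mult_right_mono mult_left_mono) auto
      then have "(2 * exp 1 * (n / u) * exp (- (L / 4))) ^ u \<le> ?x ^ Suc (u - 1)"
        using u0 by (subst Su[symmetric], intro power_mono) auto
      also have "\<dots> = ?x * ?x ^ (u - 1)" by simp
      also have "\<dots> \<le> ?x * (1 / 2) ^ (u - 1)"
        using x by (intro mult_left_mono power_mono) auto
      also have "\<dots> \<le> (2 * exp 1 * K + ?x) * (1 / 2) ^ (u - 1)"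
        by (intro mult_right_mono) (auto simp: K_def)
      finally show ?thesis using False by (simp add: T_def flip: power_mult_distrib)
    qed
    finally show "(n choose u) * 2 ^ u * T u \<le> (2 * exp 1 * K + ?x) * (1 / 2) ^ (u - 1)" .
  qed
  also have "\<dots> = (2 * exp 1 * K + 2 * exp 1 * L * exp (- (L / 4))) * (\<Sum>u = 1..n div 8. (1 / 2) ^ (u - 1))"
    by (simp add: sum_distrib_left)
  also have "\<dots> \<le> (2 * exp 1 * K + 2 * exp 1 * L * exp (- (L / 4))) * 2"
  proof (rule mult_left_mono)
    have "(\<Sum>u = 1..N. (1 / 2 :: real) ^ (u - 1)) = 2 - 2 * (1 / 2) ^ N" for N :: nat
      by (induction N) (auto simp: field_simps)
    then show "(\<Sum>u = 1..n div 8. (1 / 2 :: real) ^ (u - 1)) \<le> 2" by simp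
  qed (use L in \<open>auto simp: K_def\<close>)
  also have "\<dots> = 4 * exp (8 - \<omega>) + 4 * exp 1 * L * exp (- (L / 4))"
    by (simp add: K_def algebra_simps flip: exp_add)
  finally show ?thesis .
qed

section \<open>The two regimes\<close>

text \<open>With at least 16 vertices, expansion applies to singletons, so no vertex is isolated.
  This supplies the covering needed for \<open>deficiency_le_length\<close>.\<close>

lemma expander_covers:
  assumes "expander V F" "finite V" "16 \<le> card V"
  shows "V \<subseteq> \<Union>F"
proof
  fix v assume "v \<in> V"
  then have "card {v} \<le> card (nbhd V F {v})"
    using assms unfolding expander_def by auto
  then have "nbhd V F {v} \<noteq> {}" by auto
  then show "v \<in> \<Union>F" by (auto simp: nbhd_def joined_def)
qed

lemma prob_no_perfect_matching_le:
  "measure_pmf.prob (random_intersection_graph n m p) {G. \<not> has_perfect_matching G}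
    \<le> measure_pmf.prob (replicate_pmf m (random_subset {..<n} p)) {Xs. deficiency {..<n} (set Xs) > 0}"
  unfolding random_intersection_graph_eq measure_map_pmf
  by (intro measure_pmf.finite_measure_mono)
    (auto intro: Nat.gr0I dest!: perfect_matching_if_deficiency_0[rotated])

text \<open>A feature gives a fixed vertex a neighbour with probability at most \<theta>: trivially
  if \<open>p = \<theta>\<close>, by Bernoulli's inequality if
  \<open>n * p\<^sup>2 = \<theta>\<close>. The hypothesis on \<open>m * \<theta>\<^sup>2\<close>
  limits the second-order loss in (1 - \<theta>)^m to exp (-2), and \<theta> \<le> 1 / 2 turns
  \<open>p\<^sup>2 / q\<^sup>2\<close> into at most \<open>4 * p\<^sup>2\<close>.\<close>

lemma prob_perfect_matching_le:
  fixes p x \<theta> :: real and n m :: nat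
  defines "\<theta> \<equiv> (ln n + x) / m"
  assumes n: "n > 0" and m: "m > 0" and p: "p \<in> {0..1}" and th: "0 \<le> \<theta>" "\<theta> \<le> 1 / 2" "m * \<theta>\<^sup>2 \<le> 1"
    and p_eq: "p = \<theta> \<or> n * p\<^sup>2 = \<theta>"
  shows "measure_pmf.prob (random_intersection_graph n m p) {G. has_perfect_matching G}
    \<le> exp (x + 2) + exp (4 * (m * p\<^sup>2)) - 1"
proof -
  define q where "q = 1 - p * (1 - (1 - p) ^ (n - 1))"
  have "p * (1 - (1 - p) ^ (n - 1)) \<le> \<theta>"
    using p_eq
  proof
    assume "p = \<theta>"
    then show ?thesis using p by (simp add: mult_left_le)
  next
    assume np: "n * p\<^sup>2 = \<theta>"
    have "1 - (n - 1) * p \<le> (1 - p) ^ (n - 1)"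
      using Bernoulli_inequality[of "- p" "n - 1"] p by simp
    moreover have "(n - 1) * p \<le> n * p" using p by (intro mult_right_mono) auto
    ultimately have "p * (1 - (1 - p) ^ (n - 1)) \<le> p * (n * p)"
      using p by (intro mult_left_mono) auto
    also have "\<dots> = \<theta>" using np by (simp add: power2_eq_square mult_ac)
    finally show ?thesis .
  qed
  then have q: "1 - \<theta> \<le> q" by (simp add: q_def)
  then have q2: "1 / 2 \<le> q" using th by simp
  have mth: "m * \<theta> = ln n + x" using m by (simp add: \<theta>_def)
  have "exp (- \<theta> - 2 * \<theta>\<^sup>2) \<le> exp (ln (1 - \<theta>))"
    using ln_one_minus_pos_lower_bound[OF th(1,2)] by simp
  also have "\<dots> \<le> q" using th q by simp
  finally have "exp (- \<theta> - 2 * \<theta>\<^sup>2) ^ m \<le> q ^ m" by (intro power_mono) auto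
  moreover have "exp (- x - 2) / n \<le> exp (- \<theta> - 2 * \<theta>\<^sup>2) ^ m"
  proof -
    have "exp (- x - 2) / n = exp (- (m * \<theta>) - 2)"
      unfolding mth using n by (simp add: exp_diff exp_add exp_minus field_simps)
    also have "\<dots> \<le> exp (- (m * \<theta>) - 2 * (m * \<theta>\<^sup>2))" using th by simp
    also have "\<dots> = exp (- \<theta> - 2 * \<theta>\<^sup>2) ^ m" by (simp add: algebra_simps flip: exp_of_nat_mult)
    finally show ?thesis .
  qed
  ultimately have "exp (- x - 2) / n \<le> q ^ m" by (rule order_trans[rotated])
  then have "exp (- x - 2) \<le> n * q ^ m" using n by (simp add: field_simps)
  then have "1 / (n * q ^ m) \<le> 1 / exp (- x - 2)"
    using q2 n by (intro divide_left_mono) (auto intro!: mult_pos_pos)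
  also have "\<dots> = exp (x + 2)" using exp_minus[of "x + 2"] by (simp add: divide_inverse)
  finally have A: "1 / (n * q ^ m) \<le> exp (x + 2)" .
  have "p\<^sup>2 / q\<^sup>2 \<le> p\<^sup>2 / (1 / 2)\<^sup>2"
    using q2 by (intro divide_left_mono power_mono) auto
  also have "\<dots> = 4 * p\<^sup>2" by (simp add: power2_eq_square)
  finally have "1 + p\<^sup>2 / q\<^sup>2 \<le> exp (4 * p\<^sup>2)"
    using exp_ge_add_one_self[of "4 * p\<^sup>2"] by linarith
  then have "(1 + p\<^sup>2 / q\<^sup>2) ^ m \<le> exp (4 * p\<^sup>2) ^ m" by (intro power_mono) auto
  also have "\<dots> = exp (4 * (m * p\<^sup>2))" by (simp add: mult_ac flip: exp_of_nat_mult)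
  finally have B: "(1 + p\<^sup>2 / q\<^sup>2) ^ m \<le> exp (4 * (m * p\<^sup>2))" .
  have "\<exists>u<n. joined (set Xs) v u"
    if "has_perfect_matching (clique_union {..<n} (set Xs))" "v < n" for Xs v
    using perfect_matching_imp_joined[OF that(1), of v] that(2) by auto
  then have "measure_pmf.prob (random_intersection_graph n m p) {G. has_perfect_matching G}
    \<le> measure_pmf.prob (replicate_pmf m (random_subset {..<n} p)) {Xs. \<forall>v<n. \<exists>u<n. joined (set Xs) v u}"
    unfolding random_intersection_graph_eq measure_map_pmf
    by (intro measure_pmf.finite_measure_mono) auto
  also have "\<dots> \<le> 1 / (n * q ^ m) + (1 + p\<^sup>2 / q\<^sup>2) ^ m - 1"
    unfolding q_def by (rule prob_no_isolated[OF p]) (use q2 n in \<open>auto simp: q_def\<close>)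
  finally show ?thesis using A B by linarith
qed

text \<open>Half of the surplus \<open>x\<close> stays with the expansion round, the other half
  becomes the sprinkling probability \<open>b = x / (2 * m)\<close>. As m \<le> n and n div 32 is at
  least n / 64, a sprinkled feature misses n div 32 given vertices with probability at most exp (-x
  / 128).\<close>

lemma prob_deficiency_large_features:
  fixes p x L :: real and n m :: nat
  defines "L \<equiv> ln (real n)"
  assumes n: "even n" "n \<ge> 64" and m: "0 < m" "m \<le> n" and p: "p \<in> {0..1}" 
    and x: "0 \<le> x" "x \<le> L" "exp (- x / 128) \<le> 1 / 12"
    and L: "L \<ge> 8" "4 * exp 1 * L * sqrt (exp 7 / n) \<le> 1" "4 * exp 1 * L * exp (- (L / 4)) \<le> 1"
      "2 * L \<le> exp (5 / 8 * L)"
    and mp: "m * p \<ge> L + x"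
  shows "measure_pmf.prob (replicate_pmf m (random_subset {..<n} p)) {Xs. deficiency {..<n} (set Xs) > 0}
    \<le> 4 * exp (8 - x / 2) + 4 * exp 1 * L * exp (- (L / 4)) + (3 / 4) ^ m"
proof -
  define a b where "a = (L + x / 2) / m" and "b = x / 2 / m"
  have ab0: "0 \<le> a" "0 \<le> b" using x L by (auto simp: a_def b_def)
  have "a + b = (L + x) / m" using m by (simp add: a_def b_def field_simps)
  also have "\<dots> \<le> p" using mp m by (simp add: field_simps)
  finally have abp: "a + b \<le> p" .
  then have ab: "a \<in> {0..1}" "b \<in> {0..1}" using ab0 p by auto
  have "a * b \<le> 1 * b" using ab by (intro mult_right_mono) auto
  moreover have "0 \<le> a * b" using ab0 by simp
  ultimately have c: "0 \<le> a + b - a * b" "a + b - a * b \<le> p" using ab0 abp by linarith+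
  let ?V = "{..<n}" and ?R = "\<lambda>p. replicate_pmf m (random_subset {..<n} p)"
  define q where "q = (1 - (1 - b) ^ (n div 32))\<^sup>2"
  have "(1 - b) ^ (n div 32) \<le> exp (- ((n div 32) * b))"
    using ab by (intro power_one_minus_le_exp) auto
  also have "\<dots> \<le> exp (- x / 128)"
  proof -
    have "n \<le> 64 * (n div 32)" using n by linarith
    then have "real n \<le> real (64 * (n div 32))" by (rule of_nat_mono)
    then have "m \<le> 64 * real (n div 32)" using m by simp
    then have "m * b \<le> 64 * real (n div 32) * b" using ab by (intro mult_right_mono) auto
    moreover have "m * b = x / 2" using m by (simp add: b_def)
    ultimately show ?thesis by simp
  qed
  also have "\<dots> \<le> 1 / 12" by (rule x)
  \<comment> \<open>(11 / 12)^2 = 121 / 144 exceeds 5 / 6, and for q \<ge> 5 / 6 the factor 2 * (1 -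
    3 q / 4) is at most 3 / 4; so m sprinkled features beat a deficiency of m.\<close>
  finally have "(11 / 12)\<^sup>2 \<le> q" unfolding q_def by (intro power_mono) auto
  then have q: "5 / 6 \<le> q" by (simp add: power2_eq_square)
  have "q \<le> 1\<^sup>2" unfolding q_def using ab by (intro power_mono) (auto simp: power_le_one)
  have D: "deficiency ?V (set Xs) \<le> m" if "Xs \<in> set_pmf (?R a)" "expander ?V (set Xs)" for Xs
    using deficiency_le_length[of ?V Xs] expander_covers[OF that(2)] that(1) n
    by (auto simp: set_replicate_pmf)
  have "measure_pmf.prob (?R p) {Xs. deficiency ?V (set Xs) > 0}
    \<le> measure_pmf.prob (?R (a + b - a * b)) {Xs. deficiency ?V (set Xs) > 0}"
    using c p by (intro prob_deficiency_antimono) auto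
  also have "\<dots> \<le> measure_pmf.prob (pair_pmf (?R a) (?R b)) {(Xs, Ys). deficiency ?V (set Xs \<union> set Ys) > 0}"
    using ab by (intro prob_deficiency_or) auto
  also have "\<dots> \<le> measure_pmf.prob (?R a) {Xs. \<not> expander ?V (set Xs)} + 2 ^ m * (1 - 3 * q / 4) ^ m"
    using prob_deficiency_two_rounds[of ?V b "?R a" m m] D n ab by (simp add: q_def)
  also have "measure_pmf.prob (?R a) {Xs. \<not> expander ?V (set Xs)}
      \<le> 4 * exp (8 - x / 2) + 4 * exp 1 * L * exp (- (L / 4))"
    unfolding L_def
  proof (rule prob_not_expander_bound)
    have ma: "m * a = L + x / 2" using m by (simp add: a_def)
    have "L \<le> m * a" using ma x by simp
    also have "\<dots> \<le> n * a" using m ab by (intro mult_right_mono) auto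
    finally have "2 * L \<le> exp (5 / 8 * (n * a))"
      using L(4) by (elim order_trans) simp
    then have "ln n + x / 2 \<le> m * a \<and> m * a \<le> exp (5 / 8 * (n * a))"
      using ma x L by (simp add: L_def)
    then show "ln n + x / 2 \<le> m * a \<and> m * a \<le> exp (5 / 8 * (n * a)) \<or>
      ln n + x / 2 \<le> real m * n * a\<^sup>2 \<and> real m * n * a\<^sup>2 \<le> 2 * ln n \<and> 8 * ln n * (n * a) \<le> 1" ..
  qed (use ab x L in \<open>auto simp: L_def\<close>)
  also have "2 ^ m * (1 - 3 * q / 4) ^ m \<le> (3 / 4) ^ m"
    unfolding power_mult_distrib[symmetric] using q \<open>q \<le> 1\<^sup>2\<close> by (intro power_mono) auto
  finally show ?thesis by simp
qed

text \<open>The size condition on \<open>m\<close> gives 8 L n a \<le> 1, which the second-order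
  expansion requires. The sprinkled features must overcome the trivial deficiency bound n.\<close>

lemma prob_deficiency_small_features:
  fixes p x L :: real and n m :: nat
  defines "L \<equiv> ln (real n)"
  assumes n: "even n" "n \<ge> 64" and p: "p \<in> {0..1}" 
    and x: "700000 \<le> x" "x \<le> L" 
    and L: "4 * exp 1 * L * sqrt (exp 7 / n) \<le> 1" "4 * exp 1 * L * exp (- (L / 4)) \<le> 1"
    and m: "128 * n * L ^ 3 \<le> m"
    and mp: "real m * n * p\<^sup>2 \<ge> L + x"
  shows "measure_pmf.prob (replicate_pmf m (random_subset {..<n} p)) {Xs. deficiency {..<n} (set Xs) > 0}
    \<le> 4 * exp (8 - x / 2) + 4 * exp 1 * L * exp (- (L / 4)) + exp (- real n)"
proof -
  have L8: "L \<ge> 8" using x by simp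
  have n0: "real n > 0" using n by simp
  have "0 < 128 * real n * L ^ 3" using n0 L8 by simp
  then have m0: "real m > 0" using m by linarith
  \<comment> \<open>The probability is first lowered so that \<open>m * n * a\<^sup>2\<close> is
    exactly \<open>L + x\<close>: the expansion bound also needs this quantity to be at most 2
    L.\<close>
  define a where "a = sqrt ((L + x) / (real m * n))"
  have a0: "0 < a" using x L8 m0 n0 by (simp add: a_def)
  have a2: "real m * n * a\<^sup>2 = L + x" using x L8 m0 n0 by (simp add: a_def)
  have "a\<^sup>2 \<le> p\<^sup>2"
  proof -
    have "real m * n * a\<^sup>2 \<le> real m * n * p\<^sup>2" using a2 mp by simp
    then show ?thesis using m0 n0 by simp
  qed
  then have ap: "a \<le> p" using p by (auto intro: power2_le_imp_le)
  then have a: "a \<in> {0..1}" using a0 p by auto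
  have na: "8 * L * (n * a) \<le> 1"
  proof (rule power2_le_imp_le)
    have "(8 * L * (n * a))\<^sup>2 * m = 64 * L\<^sup>2 * n * (real m * n * a\<^sup>2)"
      by (simp add: power_mult_distrib power2_eq_square)
    also have "\<dots> \<le> 64 * L\<^sup>2 * n * (2 * L)" using a2 x by (intro mult_left_mono) auto
    also have "\<dots> = 128 * n * L ^ 3" by (simp add: power2_eq_square power3_eq_cube)
    also have "\<dots> \<le> 1\<^sup>2 * m" using m by simp
    finally show "(8 * L * (n * a))\<^sup>2 \<le> 1\<^sup>2" using m0 by simp
  qed simp
  \<comment> \<open>Removing this many features lowers \<open>m * n * a\<^sup>2\<close> by at most x
    (L + x) / (4 L), hence by at most x / 2, so the rest stays above the threshold.\<close>
  define l where "l = nat \<lfloor>m * x / (4 * L)\<rfloor>"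
  have fl: "0 \<le> m * x / (4 * L)" using x L8 by simp
  have l_le: "real l \<le> m * x / (4 * L)" using fl by (simp add: l_def)
  have "m * x / (4 * L) \<le> m * L / (4 * L)"
    using x L8 by (intro divide_right_mono mult_left_mono) auto
  also have "\<dots> = m / 4" using L8 by simp
  finally have lm: "real l \<le> m" using l_le m0 by linarith
  then have lm': "l \<le> m" by simp
  have l_ge: "m * x / (8 * L) \<le> l"
  proof -
    have "8 * L \<le> m * x"
    proof -
      have "128 * 1 * L ^ 1 \<le> 128 * real n * L ^ 3"
        using n L8 by (intro mult_mono power_increasing) auto
      then have "8 * L \<le> m" using m L8 by simp
      also have "\<dots> \<le> m * x" using m0 x by simp
      finally show ?thesis .
    qed
    then have "1 \<le> m * x / (8 * L)" using L8 by (simp add: field_simps)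
    moreover have "m * x / (4 * L) = 2 * (m * x / (8 * L))" by simp
    moreover have "m * x / (4 * L) - 1 \<le> l" using fl unfolding l_def by linarith
    ultimately show ?thesis by linarith
  qed
  let ?V = "{..<n}" and ?R = "\<lambda>k. replicate_pmf k (random_subset {..<n} a)"
  define h where "h = n div 32"
  define q where "q = (1 - (1 - a) ^ h)\<^sup>2"
  have "n \<le> 64 * h" using n unfolding h_def by linarith
  then have h_ge: "n / 64 \<le> h" by (simp add: field_simps flip: of_nat_mult) 
  have h_le: "real h \<le> n" by (simp add: h_def)
  have ha: "h * a \<le> 1 / 2" "0 \<le> h * a"
  proof -
    have "h * a \<le> n * a" using h_le a by (intro mult_right_mono) auto
    also have "\<dots> \<le> L * (n * a)" using L8 a0 mult_right_mono[of 1 L "n * a"] by simp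
    finally show "h * a \<le> 1 / 2" using na by simp
  qed (use a in auto)
  have "(1 - a) ^ h \<le> exp (- (h * a))" using a by (intro power_one_minus_le_exp) auto
  also have "\<dots> \<le> 1 - h * a + (h * a)\<^sup>2" by (rule exp_minus_le_quadratic[OF ha(2)])
  also have "(h * a)\<^sup>2 \<le> (1 / 2) * (h * a)"
    unfolding power2_eq_square using ha by (intro mult_right_mono) auto
  finally have "(1 - a) ^ h \<le> 1 - h * a + 1 / 2 * (h * a)" by simp
  then have "h * a / 2 \<le> 1 - (1 - a) ^ h" by linarith
  moreover have "n * a / 128 \<le> h * a / 2"
    using mult_right_mono[OF h_ge, of a] a0 by simp
  ultimately have "n * a / 128 \<le> 1 - (1 - a) ^ h" by linarith
  then have q_ge: "(n * a / 128)\<^sup>2 \<le> q" unfolding q_def using a0 by (intro power_mono) auto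
  have q1: "q \<le> 1\<^sup>2" "0 \<le> q" unfolding q_def using a by (auto intro!: power_mono simp: power_le_one)
  \<comment> \<open>Here 131072 = 128^2 * 8 combines the bounds for \<open>q\<close> and
    \<open>l\<close>, and 7 / 2 * 131072 = 458752 lies below the assumed 700000. Since 3 / 4 * 7 / 2
    exceeds 2, sprinkling yields exp (-2 n) against the 2^n of the deficiency.\<close>
  have ql: "7 / 2 * n \<le> q * l"
  proof -
    have "7 / 2 * n \<le> n * x / 131072" using x n0 by (simp add: field_simps)
    also have "\<dots> = n * L * x / (131072 * L)" using L8 by simp
    also have "\<dots> \<le> n * (L + x) * x / (131072 * L)"
      using x L8 by (intro divide_right_mono mult_left_mono mult_right_mono) auto
    also have "\<dots> = (n * a / 128)\<^sup>2 * (m * x / (8 * L))"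
      unfolding a2[symmetric] by (simp add: power2_eq_square)
    also have "\<dots> \<le> q * l" using q_ge l_ge q1 x L8 by (intro mult_mono) auto
    finally show ?thesis .
  qed
  have sp: "2 ^ n * (1 - 3 * q / 4) ^ l \<le> exp (- real n)"
  proof -
    have "(1 - 3 * q / 4) ^ l \<le> exp (- (l * (3 * q / 4)))"
      using q1 by (intro power_one_minus_le_exp) auto
    also have "\<dots> \<le> exp (- (2 * real n))" using ql by (simp add: mult_ac)
    finally have "2 ^ n * (1 - 3 * q / 4) ^ l \<le> exp 1 ^ n * exp (- (2 * real n))"
      using q1 exp_ge_add_one_self[of 1] by (intro mult_mono power_mono) auto
    also have "\<dots> = exp (- real n)" by (simp flip: exp_of_nat_mult exp_add)
    finally show ?thesis .
  qed
  have "measure_pmf.prob (replicate_pmf m (random_subset ?V p)) {Xs. deficiency ?V (set Xs) > 0}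
    \<le> measure_pmf.prob (?R m) {Xs. deficiency ?V (set Xs) > 0}"
    using a ap p by (intro prob_deficiency_antimono) auto
  also have "?R m = ?R ((m - l) + l)" using lm' by simp
  also have "measure_pmf.prob (?R ((m - l) + l)) {Xs. deficiency ?V (set Xs) > 0} =
      measure_pmf.prob (pair_pmf (?R (m - l)) (?R l)) {(Xs, Ys). deficiency ?V (set Xs \<union> set Ys) > 0}"
    unfolding replicate_pmf_add measure_map_pmf by (intro arg_cong2[where f = measure_pmf.prob]) (auto simp: Un_def)
  also have "\<dots> \<le> measure_pmf.prob (?R (m - l)) {Xs. \<not> expander ?V (set Xs)} + 2 ^ n * (1 - 3 * q / 4) ^ l"
    using prob_deficiency_two_rounds[of ?V a "?R (m - l)" n l] deficiency_le_card[of ?V] n a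
    by (simp add: q_def h_def)
  also have "measure_pmf.prob (?R (m - l)) {Xs. \<not> expander ?V (set Xs)}
      \<le> 4 * exp (8 - x / 2) + 4 * exp 1 * L * exp (- (L / 4))"
    unfolding L_def
  proof (rule prob_not_expander_bound)
    have na2: "0 \<le> n * a\<^sup>2" by simp
    have ml: "real (m - l) = m - real l" using lm' by (simp add: of_nat_diff)
    have "l * (n * a\<^sup>2) \<le> m * x / (4 * L) * (n * a\<^sup>2)" by (rule mult_right_mono[OF l_le na2])
    also have "\<dots> = (L + x) * x / (4 * L)" unfolding a2[symmetric] by (simp add: mult_ac)
    also have "\<dots> \<le> (2 * L) * x / (4 * L)" using x L8 by (intro divide_right_mono mult_right_mono) auto
    also have "\<dots> = x / 2" using L8 by simp
    finally have "L + x / 2 \<le> real (m - l) * n * a\<^sup>2"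
      unfolding ml using a2 by (simp add: algebra_simps)
    moreover have "real (m - l) * n * a\<^sup>2 \<le> real m * n * a\<^sup>2" by (intro mult_right_mono) auto
    ultimately have "ln n + x / 2 \<le> real (m - l) * n * a\<^sup>2 \<and> real (m - l) * n * a\<^sup>2 \<le> 2 * ln n \<and> 8 * ln n * (n * a) \<le> 1"
      using a2 x na unfolding L_def by linarith
    then show "ln n + x / 2 \<le> (m - l) * a \<and> (m - l) * a \<le> exp (5 / 8 * (n * a)) \<or>
      ln n + x / 2 \<le> real (m - l) * n * a\<^sup>2 \<and> real (m - l) * n * a\<^sup>2 \<le> 2 * ln n \<and> 8 * ln n * (n * a) \<le> 1" ..
  qed (use a x L L8 in \<open>auto simp: L_def\<close>)
  also note sp
  finally show ?thesis by simp
qed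

section \<open>Passage to the limit along even n\<close>

lemma even_sequentially_le: "even_sequentially \<le> sequentially"
  by (simp add: even_sequentially_def)

lemma eventually_even: "eventually P sequentially \<Longrightarrow> \<forall>\<^sub>F n in even_sequentially. even n \<and> P n"
  unfolding even_sequentially_def eventually_inf_principal by (auto elim: eventually_mono)

lemma tendsto_even: "(f \<longlongrightarrow> l) sequentially \<Longrightarrow> (f \<longlongrightarrow> l) even_sequentially"
  by (rule tendsto_mono[OF even_sequentially_le])

lemma filterlim_even: "filterlim f G sequentially \<Longrightarrow> filterlim f G even_sequentially"
  by (rule filterlim_mono[OF _ order_refl even_sequentially_le])

lemma rounded_powr_bounds:
  fixes \<alpha> :: real and n m :: nat
  assumes "m \<in> {nat \<lfloor>real n powr \<alpha>\<rfloor>, nat \<lceil>real n powr \<alpha>\<rceil>}"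
  shows "2 \<le> real n powr \<alpha> \<Longrightarrow> real n powr \<alpha> / 2 \<le> m"
    and "0 < n \<Longrightarrow> \<alpha> \<le> 1 \<Longrightarrow> m \<le> n"
proof -
  have "real n powr \<alpha> - 1 \<le> m" using assms by auto linarith+
  then show "2 \<le> real n powr \<alpha> \<Longrightarrow> real n powr \<alpha> / 2 \<le> m" by linarith
next
  assume "0 < n" "\<alpha> \<le> 1"
  then have "real n powr \<alpha> \<le> real n powr 1" by (intro powr_mono) auto
  then have "real n powr \<alpha> \<le> n" using \<open>0 < n\<close> by simp
  then have "\<lceil>real n powr \<alpha>\<rceil> \<le> int n" by (simp add: ceiling_le_iff)
  moreover from this have "\<lfloor>real n powr \<alpha>\<rfloor> \<le> int n" by (rule order_trans[OF floor_le_ceiling])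
  ultimately show "m \<le> n" using assms by (metis nat_le_iff insertE singletonD)
qed

lemma matching_prob_small:
  fixes \<alpha> x :: real and n m :: nat
  assumes "\<alpha> > 1" "n > 0" "m > 0" "matching_prob \<alpha> n m x \<ge> 0"
  shows "ln n + x \<ge> 0" "real m * n * (matching_prob \<alpha> n m x)\<^sup>2 = ln n + x"
proof -
  have "0 \<le> (ln n + x) / (real n * m)" using assms by (simp add: matching_prob_def)
  then show *: "ln n + x \<ge> 0" 
    using assms pos_le_divide_eq[of "real n * m" 0 "ln n + x"] by simp
  then show "real m * n * (matching_prob \<alpha> n m x)\<^sup>2 = ln n + x"
    using assms by (simp add: matching_prob_def)
qed

lemma prob_perfect_matching_tendsto_0:
  fixes \<alpha> :: real and \<omega> :: "nat \<Rightarrow> real" and m :: "nat \<Rightarrow> nat"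
  assumes \<alpha>: "\<alpha> > 0"
    and m: "\<And>n. even n \<Longrightarrow> n > 0 \<Longrightarrow>
           m n \<in> {nat \<lfloor>real n powr \<alpha>\<rfloor>, nat \<lceil>real n powr \<alpha>\<rceil>}"
    and p: "\<And>n. even n \<Longrightarrow> n > 0 \<Longrightarrow> matching_prob \<alpha> n (m n) (\<omega> n) \<in> {0..1}"
    and \<omega>: "filterlim \<omega> at_bot even_sequentially"
  shows "((\<lambda>n. measure_pmf.prob
              (random_intersection_graph n (m n) (matching_prob \<alpha> n (m n) (\<omega> n)))
              {G. has_perfect_matching G}) \<longlongrightarrow> 0) even_sequentially"
proof -
  \<comment> \<open>A common bound for \<open>m n\<close> times the squared probability: the first
    summand bounds \<open>m n * \<theta>\<^sup>2\<close> for \<alpha> \<le> 1, using that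
    \<open>m n\<close> is at least half of n^\<alpha>; the second bounds
    \<open>m n * \<theta> / n\<close> for \<alpha> > 1.\<close>
  define \<delta> where "\<delta> n = 2 * ln (real n) ^ 2 / real n powr \<alpha> + ln (real n) / n" for n :: nat
  have "((\<lambda>y::real. exp (y + 2)) \<longlongrightarrow> 0) at_bot" by real_asymp
  then have 1: "((\<lambda>n. exp (\<omega> n + 2)) \<longlongrightarrow> 0) even_sequentially"
    by (rule filterlim_compose[OF _ \<omega>])
  have "(\<lambda>n::nat. 2 * ln (real n) ^ 2 / real n powr \<alpha>) \<longlonglongrightarrow> 0" using \<alpha> by real_asymp
  moreover have "(\<lambda>n::nat. ln (real n) / n) \<longlonglongrightarrow> 0" by real_asymp
  ultimately have "\<delta> \<longlonglongrightarrow> 0" unfolding \<delta>_def by (rule tendsto_add_zero)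
  then have "(\<delta> \<longlongrightarrow> 0) even_sequentially" by (rule tendsto_even)
  then have "((\<lambda>n. exp (4 * \<delta> n)) \<longlongrightarrow> exp (4 * 0)) even_sequentially"
    by (intro tendsto_intros)
  from tendsto_diff[OF tendsto_add[OF 1 this] tendsto_const, of 1]
  have lim: "((\<lambda>n. exp (\<omega> n + 2) + exp (4 * \<delta> n) - 1) \<longlongrightarrow> 0) even_sequentially" by simp
  have e: "\<forall>\<^sub>F n in sequentially. n > 0 \<and> 2 \<le> real n powr \<alpha> \<and>
      2 * ln (real n) / real n powr \<alpha> \<le> 1 / 2 \<and> 2 * ln (real n) ^ 2 / real n powr \<alpha> \<le> 1"
  proof (intro eventually_conj)
    show "\<forall>\<^sub>F n in sequentially. (n :: nat) > 0" by (rule eventually_gt_at_top)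
    show "\<forall>\<^sub>F n in sequentially. 2 \<le> real n powr \<alpha>" using \<alpha> by real_asymp
    show "\<forall>\<^sub>F n in sequentially. 2 * ln (real n) / real n powr \<alpha> \<le> 1 / 2" using \<alpha> by real_asymp
    show "\<forall>\<^sub>F n in sequentially. 2 * ln (real n) ^ 2 / real n powr \<alpha> \<le> 1" using \<alpha> by real_asymp
  qed
  have "\<forall>\<^sub>F n in even_sequentially. \<omega> n \<le> 0"
    using \<omega> by (auto simp: filterlim_at_bot)
  then have "\<forall>\<^sub>F n in even_sequentially. measure_pmf.prob
              (random_intersection_graph n (m n) (matching_prob \<alpha> n (m n) (\<omega> n)))
              {G. has_perfect_matching G} \<le> exp (\<omega> n + 2) + exp (4 * \<delta> n) - 1"
    using eventually_even[OF e]
  proof eventually_elim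
    case (elim n)
    let ?p = "matching_prob \<alpha> n (m n) (\<omega> n)" and ?L = "ln (real n)" and ?N = "real n powr \<alpha>"
    define \<theta> where "\<theta> = (?L + \<omega> n) / m n"
    have n0: "n > 0" and pn: "?p \<in> {0..1}" using elim p by auto
    have mN: "?N / 2 \<le> m n" using rounded_powr_bounds(1)[OF m] elim by auto
    then have m0: "0 < m n" using elim by (cases "m n") auto
    have L0: "0 \<le> ?L" using n0 by simp
    have np: "\<not> \<alpha> \<le> 1 \<Longrightarrow> real (m n) * n * ?p\<^sup>2 = ?L + \<omega> n"
      using matching_prob_small[of \<alpha> n "m n" "\<omega> n"] n0 m0 pn by auto
    have Lw: "0 \<le> ?L + \<omega> n"
    proof (cases "\<alpha> \<le> 1")
      case True
      then show ?thesis using pn m0 by (simp add: matching_prob_def zero_le_divide_iff)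
    next
      case False
      then show ?thesis using matching_prob_small(1)[of \<alpha> n "m n" "\<omega> n"] n0 m0 pn by auto
    qed
    have p_eq: "\<alpha> \<le> 1 \<and> ?p = \<theta> \<or> \<not> \<alpha> \<le> 1 \<and> n * ?p\<^sup>2 = \<theta>"
      using np m0 by (auto simp: matching_prob_def \<theta>_def field_simps)
    have th: "0 \<le> \<theta>" using Lw by (simp add: \<theta>_def)
    have "\<theta> \<le> ?L / m n" unfolding \<theta>_def using elim by (intro divide_right_mono) auto
    also have "\<dots> \<le> ?L / (?N / 2)" using mN L0 elim by (intro divide_left_mono) auto
    finally have thN: "\<theta> \<le> 2 * ?L / ?N" by (simp add: mult.commute)
    have mth: "m n * \<theta> \<le> ?L" using elim m0 by (simp add: \<theta>_def)
    have "m n * \<theta>\<^sup>2 = (m n * \<theta>) * \<theta>" by (simp add: power2_eq_square)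
    also have "\<dots> \<le> ?L * (2 * ?L / ?N)" using mth thN th L0 by (intro mult_mono) auto
    also have "\<dots> = 2 * ?L ^ 2 / ?N" by (simp add: power2_eq_square)
    finally have mth2: "m n * \<theta>\<^sup>2 \<le> 2 * ?L ^ 2 / ?N" .
    have "m n * ?p\<^sup>2 \<le> \<delta> n"
      using p_eq
    proof (elim disjE conjE)
      assume "?p = \<theta>"
      moreover have "0 \<le> ?L / n" using L0 by simp
      ultimately show ?thesis using mth2 unfolding \<delta>_def by simp
    next
      assume "n * ?p\<^sup>2 = \<theta>"
      then have "m n * ?p\<^sup>2 = m n * \<theta> / n" using n0 by (simp add: field_simps)
      also have "\<dots> \<le> ?L / n" using mth by (intro divide_right_mono) auto
      also have "\<dots> \<le> \<delta> n" by (simp add: \<delta>_def)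
      finally show ?thesis .
    qed
    moreover have "measure_pmf.prob (random_intersection_graph n (m n) ?p) {G. has_perfect_matching G}
      \<le> exp (\<omega> n + 2) + exp (4 * (m n * ?p\<^sup>2)) - 1"
    proof (rule prob_perfect_matching_le[OF n0 m0 pn, of "\<omega> n", folded \<theta>_def])
      show "0 \<le> \<theta>" by (rule th)
      show "\<theta> \<le> 1 / 2" using thN elim by linarith
      show "m n * \<theta>\<^sup>2 \<le> 1" using mth2 elim by linarith
      show "?p = \<theta> \<or> n * ?p\<^sup>2 = \<theta>" using p_eq by blast
    qed
    ultimately show ?case by (smt (verit) exp_le_cancel_iff)
  qed
  then show ?thesis
    by (rule tendsto_sandwich[OF _ _ tendsto_const lim, rotated]) simp
qed

lemma prob_no_perfect_matching_tendsto_0: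
  fixes \<alpha> :: real and \<omega> :: "nat \<Rightarrow> real" and m :: "nat \<Rightarrow> nat"
  assumes \<alpha>: "\<alpha> > 0"
    and m: "\<And>n. even n \<Longrightarrow> n > 0 \<Longrightarrow>
           m n \<in> {nat \<lfloor>real n powr \<alpha>\<rfloor>, nat \<lceil>real n powr \<alpha>\<rceil>}"
    and p: "\<And>n. even n \<Longrightarrow> n > 0 \<Longrightarrow> matching_prob \<alpha> n (m n) (\<omega> n) \<in> {0..1}"
    and \<omega>: "filterlim \<omega> at_top even_sequentially"
  shows "((\<lambda>n. measure_pmf.prob
              (random_intersection_graph n (m n) (matching_prob \<alpha> n (m n) (\<omega> n)))
              {G. \<not> has_perfect_matching G}) \<longlongrightarrow> 0) even_sequentially"
proof -
  \<comment> \<open>Truncation at ln n: the finite estimates require x \<le> L, and they ask only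
    for a lower bound on the edge density, so a faster growing \<omega> is covered as well.\<close>
  define x where "x n = min (\<omega> n) (ln (real n))" for n :: nat
  have "filterlim (\<lambda>n::nat. ln (real n)) at_top sequentially" by real_asymp
  from filterlim_even[OF this] have xlim: "filterlim x at_top even_sequentially"
    using \<omega> unfolding x_def filterlim_at_top by (simp add: eventually_conj_iff)
  define r where "r n = (3 / 4 :: real) ^ m n + exp (- real n)" for n
  define \<epsilon> where "\<epsilon> n = 4 * exp (8 - x n / 2) + 4 * exp 1 * ln (real n) * exp (- (ln (real n) / 4)) + r n"
    for n
  have e: "\<forall>\<^sub>F n in sequentially. n \<ge> 64 \<and> 2 \<le> real n powr \<alpha> \<and>
      8 \<le> ln (real n) \<and> 4 * exp 1 * ln (real n) * sqrt (exp 7 / real n) \<le> 1 \<and>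
      4 * exp 1 * ln (real n) * exp (- (ln (real n) / 4)) \<le> 1 \<and>
      2 * ln (real n) \<le> exp (5 / 8 * ln (real n)) \<and>
      (\<alpha> > 1 \<longrightarrow> 256 * real n * ln (real n) ^ 3 \<le> real n powr \<alpha>)"
  proof (intro eventually_conj)
    show "\<forall>\<^sub>F n in sequentially. (n :: nat) \<ge> 64" by (rule eventually_ge_at_top)
    show "\<forall>\<^sub>F n in sequentially. 2 \<le> real n powr \<alpha>" using \<alpha> by real_asymp
    show "\<forall>\<^sub>F n in sequentially. 8 \<le> ln (real n)" by real_asymp
    show "\<forall>\<^sub>F n in sequentially. 4 * exp 1 * ln (real n) * sqrt (exp 7 / real n) \<le> 1" by real_asymp
    show "\<forall>\<^sub>F n in sequentially. 4 * exp 1 * ln (real n) * exp (- (ln (real n) / 4)) \<le> 1" by real_asymp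
    show "\<forall>\<^sub>F n in sequentially. 2 * ln (real n) \<le> exp (5 / 8 * ln (real n))" by real_asymp
    show "\<forall>\<^sub>F n in sequentially. \<alpha> > 1 \<longrightarrow> 256 * real n * ln (real n) ^ 3 \<le> real n powr \<alpha>"
    proof (cases "\<alpha> > 1")
      case True
      then have "\<forall>\<^sub>F n in sequentially. 256 * real n * ln (real n) ^ 3 \<le> real n powr \<alpha>" by real_asymp
      then show ?thesis by (rule eventually_mono) simp
    qed simp
  qed
  have mlim: "filterlim m at_top even_sequentially"
    unfolding filterlim_sequentially_iff_filterlim_real
  proof (rule filterlim_at_top_mono)
    have "filterlim (\<lambda>n::nat. real n powr \<alpha> / 2) at_top sequentially" using \<alpha> by real_asymp
    then show "filterlim (\<lambda>n::nat. real n powr \<alpha> / 2) at_top even_sequentially" by (rule filterlim_even)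
    show "\<forall>\<^sub>F n in even_sequentially. real n powr \<alpha> / 2 \<le> m n"
      using eventually_even[OF e] by (rule eventually_mono) (use rounded_powr_bounds(1)[OF m] in auto)
  qed
  have lim: "(\<epsilon> \<longlongrightarrow> 0) even_sequentially"
  proof -
    have "((\<lambda>y::real. 4 * exp (8 - y / 2)) \<longlongrightarrow> 0) at_top" by real_asymp
    then have 1: "((\<lambda>n. 4 * exp (8 - x n / 2)) \<longlongrightarrow> 0) even_sequentially"
      by (rule filterlim_compose[OF _ xlim])
    have "(\<lambda>k. (3 / 4 :: real) ^ k) \<longlonglongrightarrow> 0" by (rule LIMSEQ_realpow_zero) auto
    then have 2: "((\<lambda>n. (3 / 4 :: real) ^ m n) \<longlongrightarrow> 0) even_sequentially"
      by (rule filterlim_compose[OF _ mlim])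
    have "(\<lambda>n::nat. 4 * exp 1 * ln (real n) * exp (- (ln (real n) / 4))) \<longlonglongrightarrow> 0" by real_asymp
    note 3 = tendsto_even[OF this]
    have "(\<lambda>n::nat. exp (- real n)) \<longlonglongrightarrow> 0" by real_asymp
    note 4 = tendsto_even[OF this]
    show ?thesis
      using tendsto_add[OF tendsto_add[OF 1 3] tendsto_add[OF 2 4]] by (simp add: \<epsilon>_def[abs_def] r_def[abs_def])
  qed
  have "\<forall>\<^sub>F n in even_sequentially. 700000 \<le> x n"
    using xlim by (auto simp: filterlim_at_top)
  then have "\<forall>\<^sub>F n in even_sequentially. measure_pmf.prob
              (random_intersection_graph n (m n) (matching_prob \<alpha> n (m n) (\<omega> n)))
              {G. \<not> has_perfect_matching G} \<le> \<epsilon> n"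
    using eventually_even[OF e]
  proof eventually_elim
    case (elim n)
    let ?p = "matching_prob \<alpha> n (m n) (\<omega> n)" and ?L = "ln (real n)" and ?N = "real n powr \<alpha>"
    have n0: "n > 0" and pn: "?p \<in> {0..1}" using elim p by auto
    have mN: "?N / 2 \<le> m n" using rounded_powr_bounds(1)[OF m] elim by auto
    then have m0: "0 < m n" using elim by (cases "m n") auto
    have xL: "x n \<le> ?L" "x n \<le> \<omega> n" by (simp_all add: x_def)
    have "measure_pmf.prob (replicate_pmf (m n) (random_subset {..<n} ?p))
        {Xs. deficiency {..<n} (set Xs) > 0} \<le> \<epsilon> n"
    proof (cases "\<alpha> \<le> 1")
      case True
      have "m n * ?p = ?L + \<omega> n" using m0 True by (simp add: matching_prob_def)
      moreover have "exp (- x n / 128) \<le> 1 / 12"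
      proof -
        have "12 \<le> exp (x n / 128)" using exp_ge_add_one_self[of "x n / 128"] elim by linarith
        then show ?thesis by (simp add: exp_minus field_simps)
      qed
      moreover have "m n \<le> n" using rounded_powr_bounds(2)[OF m] True n0 elim by auto
      ultimately have "measure_pmf.prob (replicate_pmf (m n) (random_subset {..<n} ?p))
          {Xs. deficiency {..<n} (set Xs) > 0}
        \<le> 4 * exp (8 - x n / 2) + 4 * exp 1 * ?L * exp (- (?L / 4)) + (3 / 4) ^ m n"
        by (intro prob_deficiency_large_features) (use elim m0 pn xL in auto)
      then show ?thesis unfolding \<epsilon>_def r_def using exp_ge_zero[of "- real n"] by linarith
    next
      case False
      have "real (m n) * n * ?p\<^sup>2 = ?L + \<omega> n"
        using matching_prob_small(2)[of \<alpha> n "m n" "\<omega> n"] False n0 m0 pn by auto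
      moreover have "128 * n * ?L ^ 3 \<le> m n" using mN elim False by simp
      ultimately have "measure_pmf.prob (replicate_pmf (m n) (random_subset {..<n} ?p))
          {Xs. deficiency {..<n} (set Xs) > 0}
        \<le> 4 * exp (8 - x n / 2) + 4 * exp 1 * ?L * exp (- (?L / 4)) + exp (- real n)"
        by (intro prob_deficiency_small_features) (use elim pn xL in auto)
      then show ?thesis 
        unfolding \<epsilon>_def r_def using zero_le_power[of "3 / 4 :: real" "m n"] by linarith
    qed
    then show ?case using prob_no_perfect_matching_le order_trans by blast
  qed
  then show ?thesis
    by (rule tendsto_sandwich[OF _ _ tendsto_const lim, rotated]) simp
qed

theorem theorem6:
  fixes \<alpha> :: real and \<omega> :: "nat \<Rightarrow> real" and m :: "nat \<Rightarrow> nat"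
  assumes "\<alpha> > 0"
    and "\<And>n. even n \<Longrightarrow> n > 0 \<Longrightarrow>
           m n \<in> {nat \<lfloor>real n powr \<alpha>\<rfloor>, nat \<lceil>real n powr \<alpha>\<rceil>}"
    and "\<And>n. even n \<Longrightarrow> n > 0 \<Longrightarrow> matching_prob \<alpha> n (m n) (\<omega> n) \<in> {0..1}"
  shows "(filterlim \<omega> at_bot even_sequentially \<longrightarrow>
           ((\<lambda>n. measure_pmf.prob
                   (random_intersection_graph n (m n) (matching_prob \<alpha> n (m n) (\<omega> n)))
                   {G. \<not> has_perfect_matching G}) \<longlongrightarrow> 1) even_sequentially) \<and>
         (filterlim \<omega> at_top even_sequentially \<longrightarrow>
           ((\<lambda>n. measure_pmf.prob
                   (random_intersection_graph n (m n) (matching_prob \<alpha> n (m n) (\<omega> n)))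
                   {G. has_perfect_matching G}) \<longlongrightarrow> 1) even_sequentially)"
proof (intro conjI impI)
  let ?P = "\<lambda>n. random_intersection_graph n (m n) (matching_prob \<alpha> n (m n) (\<omega> n))"
  have compl: "measure_pmf.prob (?P n) {G. \<not> Q G} = 1 - measure_pmf.prob (?P n) {G. Q G}" for n Q
    using measure_pmf.prob_compl[of "{G. Q G}" "?P n"] by (simp add: Compl_eq_Diff_UNIV[symmetric] Collect_neg_eq)
  show "((\<lambda>n. measure_pmf.prob (?P n) {G. \<not> has_perfect_matching G}) \<longlongrightarrow> 1) even_sequentially"
    if "filterlim \<omega> at_bot even_sequentially"
    unfolding compl using tendsto_diff[OF tendsto_const prob_perfect_matching_tendsto_0[OF assms that], of 1]
    by simp
  show "((\<lambda>n. measure_pmf.prob (?P n) {G. has_perfect_matching G}) \<longlongrightarrow> 1) even_sequentially"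
    if "filterlim \<omega> at_top even_sequentially"
    using tendsto_diff[OF tendsto_const prob_no_perfect_matching_tendsto_0[OF assms that], of 1]
    unfolding compl by simp
qed

end
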